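(* Let $g\ge 2$, let $K$ be a field, and consider the presentation $\langle c_1,\ldots,c_{2g}\mid c_{2g}\cdots c_1=c_1\cdots c_{2g}\rangle$ of the fundamental group of the closed oriented surface of genus $g$. Order the words in $c_1^{\pm1},\ldots,c_{2g}^{\pm1}$ by the length-lexicographical order induced by $$c_{2g}^{-1}\succ\cdots\succ c_2^{-1}\succ c_1^{-1}\succ c_1\succ c_2\succ\cdots\succ c_{2g}.$$ Then the set $D$ consisting of the following polynomials is a Gröbner-Shirshov basis of the ideal of the group with respect to this presentation: (1) $D_{(1,j,s)}=c_j(c_{j-1}\cdots c_1c_{2g}^{-1}\cdots c_{j+1}^{-1})^s c_j^{-1}-(c_{j+1}^{-1}\cdots c_{2g}^{-1}c_1\cdots c_{j-1})^s$ for $j=2,\ldots,2g$ and $s=1,2,\ldots$; (2) $D_{(2,j,s)}=c_j(c_{j+1}\cdots c_{2g}c_1^{-1}\cdots c_{j-1}^{-1})^s c_j^{-1}-(c_{j-1}^{-1}\cdots c_1^{-1}c_{2g}\cdots c_{j+1})^s$ for $j=2,\ldots,2g$ and $s=1,2,\ldots$; (3) $D_{(3)}=c_{2g}^{-1}\cdots c_1^{-1}-c_1^{-1}\cdots c_{2g}^{-1}$; (4) $D_{(4)}=c_1\cdots c_{2g}-c_{2g}\cdots c_1$; (5) $D_{(5,i)}=c_i^{-1}\cdots c_{2g}^{-1}c_1\cdots c_{i-1}-c_{i-1}\cdots c_1c_{2g}^{-1}\cdots c_i^{-1}$ for $i=2,\ldots,2g$; (6) $D_{(6,i)}=c_{i-1}^{-1}\cdots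 c_1^{-1}c_{2g}\cdots c_i-c_i\cdots c_{2g}c_1^{-1}\cdots c_{i-1}^{-1}$ for $i=2,\ldots,2g$; (7) $D_{(7,i)}=c_i^{-1}c_i-1$ for $i=1,\ldots,2g$; (8) $D_{(8,i)}=c_ic_i^{-1}-1$ for $i=1,\ldots,2g$.
   Context: Let $K\langle X\rangle$ be the free associative non-commutative $K$-algebra on the $4g$ symbols $X=\{c_1,c_1^{-1},\ldots,c_{2g},c_{2g}^{-1}\}$. The ideal of the group with respect to the presentation is the two-sided ideal $I\subset K\langle X\rangle$ generated by $c_1\cdots c_{2g}-c_{2g}\cdots c_1$ and $c_ic_i^{-1}-1$, $c_i^{-1}c_i-1$ ($1\le i\le 2g$). Length-lexicographical order: $\alpha\succ\beta$ if $|\alpha|>|\beta|$, or $|\alpha|=|\beta|$ and at the first position where they differ the letter of $\alpha$ is larger ($\succ$) than that of $\beta$. The leading word $\mathrm{lw}(f)$ of a nonzero polynomial $f$ is its largest word, with leading coefficient $\mathrm{lc}(f)$. A polynomial $f$ reduces $f'$ to $f''$ if $\mathrm{lw}(f')=\gamma\,\mathrm{lw}(f)\,\delta$ for words $\gamma,\delta$ and $f''=f'-\frac{\mathrm{lc}(f')}{\mathrm{lc}(f)}\gamma f\delta$. A set $B$ reduces $f'$ to $f''$ if $f''$ is obtained from $f'$ by finitely many reductions by elements of $B$. A generating set $B$ of an ideal $I$ is a Gröbner-Shirshov basis of $I$ if a polynomial lies in $I$ if and only if it is reduced to $0$ by $B$. Conventions: in the words above, runs such as $c_{j-1}\cdots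 c_1$ have consecutively decreasing indices and $c_{j+1}^{-1}\cdots c_{2g}^{-1}$ consecutively increasing ones, etc.; a run such as $c_{2g}^{-1}\cdots c_{j+1}^{-1}$ or $c_{j+1}\cdots c_{2g}$ is empty when $j=2g$. *)

theory Defs
  imports "HOL-Library.Poly_Mapping" "HOL-Algebra.Ideal"
begin

text \<open>
  The words over an alphabet form the free monoid under concatenation. Written additively, as
  required by \<^theory>\<open>HOL-Library.Poly_Mapping\<close>, this makes
  \<open>'x list \<Rightarrow>\<^sub>0 'k\<close> with its convolution product the free associative \<open>'k\<close>-algebra
  on all of \<open>'x\<close>.
\<close>

instantiation list :: (type) monoid_add
begin

definition zero_list :: "'a list" where "zero_list = []"

definition plus_list :: "'a list \<Rightarrow> 'a list \<Rightarrow> 'a list" where "plus_list = (@)"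

instance
  by standard (simp_all add: zero_list_def plus_list_def)

end

type_synonym ('x, 'k) nc_poly = "'x list \<Rightarrow>\<^sub>0 'k"

definition free_algebra :: "'x set \<Rightarrow> ('x, 'k::field) nc_poly ring" where
  "free_algebra X =
     \<lparr>carrier = {f. Poly_Mapping.keys f \<subseteq> lists X}, mult = (*), one = 1, zero = 0, add = (+)\<rparr>"

definition word_poly :: "'x list \<Rightarrow> ('x, 'k::field) nc_poly" where
  "word_poly w = Poly_Mapping.single w 1"

definition const_poly :: "'k \<Rightarrow> ('x, 'k::field) nc_poly" where
  "const_poly a = Poly_Mapping.single [] a"

text \<open>
  Below, \<open>r\<close> is a strict order on words, with \<open>(v, w) \<in> r\<close> meaning that \<open>v\<close> is smaller than \<open>w\<close>.
\<close>

definition leading_word :: "('x list \<times> 'x list) set \<Rightarrow> ('x, 'k::field) nc_poly \<Rightarrow> 'x list" where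
  "leading_word r f =
     (THE w. w \<in> Poly_Mapping.keys f \<and> (\<forall>v \<in> Poly_Mapping.keys f. v \<noteq> w \<longrightarrow> (v, w) \<in> r))"

definition leading_coeff :: "('x list \<times> 'x list) set \<Rightarrow> ('x, 'k::field) nc_poly \<Rightarrow> 'k" where
  "leading_coeff r f = Poly_Mapping.lookup f (leading_word r f)"

definition reduces ::
  "('x list \<times> 'x list) set \<Rightarrow> ('x, 'k::field) nc_poly \<Rightarrow> ('x, 'k) nc_poly \<Rightarrow> ('x, 'k) nc_poly \<Rightarrow> bool"
  where
  "reduces r f f' f'' \<longleftrightarrow> f \<noteq> 0 \<and> f' \<noteq> 0 \<and>
     (\<exists>\<gamma> \<delta>. leading_word r f' = \<gamma> @ leading_word r f @ \<delta> \<and>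
        f'' = f' - const_poly (leading_coeff r f' / leading_coeff r f) *
                     (word_poly \<gamma> * f * word_poly \<delta>))"

definition set_reduces ::
  "('x list \<times> 'x list) set \<Rightarrow> ('x, 'k::field) nc_poly set \<Rightarrow>
    ('x, 'k) nc_poly \<Rightarrow> ('x, 'k) nc_poly \<Rightarrow> bool" where
  "set_reduces r B = (\<lambda>f' f''. \<exists>f\<in>B. reduces r f f' f'')\<^sup>*\<^sup>*"

definition groebner_shirshov_basis ::
  "'x set \<Rightarrow> ('x list \<times> 'x list) set \<Rightarrow> ('x, 'k::field) nc_poly set \<Rightarrow>
    ('x, 'k) nc_poly set \<Rightarrow> bool" where
  "groebner_shirshov_basis X r B I \<longleftrightarrow>
     B \<subseteq> carrier (free_algebra X) \<and>
     genideal (free_algebra X) B = I \<and>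
     (\<forall>f \<in> carrier (free_algebra X). f \<in> I \<longleftrightarrow> set_reduces r B f 0)"

text \<open>\<open>C i\<close> and \<open>Cinv i\<close> stand for the symbols $c_i$ and $c_i^{-1}$.\<close>

datatype letter = C nat | Cinv nat

definition alphabet :: "nat \<Rightarrow> letter set" where
  "alphabet g = C ` {1..2*g} \<union> Cinv ` {1..2*g}"

fun letter_less :: "letter \<Rightarrow> letter \<Rightarrow> bool" where
  "letter_less (C i) (C j) \<longleftrightarrow> j < i"
| "letter_less (C i) (Cinv j) \<longleftrightarrow> True"
| "letter_less (Cinv i) (C j) \<longleftrightarrow> False"
| "letter_less (Cinv i) (Cinv j) \<longleftrightarrow> i < j"

text \<open>\<^const>\<open>lenlex\<close> compares lengths first and then the first letters that differ.\<close>

definition word_order :: "(letter list \<times> letter list) set" where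
  "word_order = lenlex {(a, b). letter_less a b}"

text \<open>
  Runs from index \<open>a\<close> to index \<open>b\<close>: \<open>up\<close> is empty for \<open>a > b\<close>, \<open>down\<close> is empty for \<open>a < b\<close>.
\<close>

definition up :: "(nat \<Rightarrow> letter) \<Rightarrow> nat \<Rightarrow> nat \<Rightarrow> letter list" where
  "up c a b = map c [a..<Suc b]"

definition down :: "(nat \<Rightarrow> letter) \<Rightarrow> nat \<Rightarrow> nat \<Rightarrow> letter list" where
  "down c a b = map c (rev [b..<Suc a])"

definition word_pow :: "letter list \<Rightarrow> nat \<Rightarrow> letter list" where
  "word_pow w s = concat (replicate s w)"

definition surface_group_ideal :: "nat \<Rightarrow> (letter, 'k::field) nc_poly set" where
  "surface_group_ideal g = genideal (free_algebra (alphabet g))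
     ({word_poly (up C 1 (2*g)) - word_poly (down C (2*g) 1)} \<union>
      {word_poly [C i, Cinv i] - 1 | i. i \<in> {1..2*g}} \<union>
      {word_poly [Cinv i, C i] - 1 | i. i \<in> {1..2*g}})"

definition D1 :: "nat \<Rightarrow> nat \<Rightarrow> nat \<Rightarrow> (letter, 'k::field) nc_poly" where
  "D1 g j s =
     word_poly ([C j] @ word_pow (down C (j-1) 1 @ down Cinv (2*g) (j+1)) s @ [Cinv j])
     - word_poly (word_pow (up Cinv (j+1) (2*g) @ up C 1 (j-1)) s)"

definition D2 :: "nat \<Rightarrow> nat \<Rightarrow> nat \<Rightarrow> (letter, 'k::field) nc_poly" where
  "D2 g j s =
     word_poly ([C j] @ word_pow (up C (j+1) (2*g) @ up Cinv 1 (j-1)) s @ [Cinv j])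
     - word_poly (word_pow (down Cinv (j-1) 1 @ down C (2*g) (j+1)) s)"

definition D3 :: "nat \<Rightarrow> (letter, 'k::field) nc_poly" where
  "D3 g = word_poly (down Cinv (2*g) 1) - word_poly (up Cinv 1 (2*g))"

definition D4 :: "nat \<Rightarrow> (letter, 'k::field) nc_poly" where
  "D4 g = word_poly (up C 1 (2*g)) - word_poly (down C (2*g) 1)"

definition D5 :: "nat \<Rightarrow> nat \<Rightarrow> (letter, 'k::field) nc_poly" where
  "D5 g i =
     word_poly (up Cinv i (2*g) @ up C 1 (i-1)) - word_poly (down C (i-1) 1 @ down Cinv (2*g) i)"

definition D6 :: "nat \<Rightarrow> nat \<Rightarrow> (letter, 'k::field) nc_poly" where
  "D6 g i =
     word_poly (down Cinv (i-1) 1 @ down C (2*g) i) - word_poly (up C i (2*g) @ up Cinv 1 (i-1))"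

definition D7 :: "nat \<Rightarrow> (letter, 'k::field) nc_poly" where
  "D7 i = word_poly [Cinv i, C i] - 1"

definition D8 :: "nat \<Rightarrow> (letter, 'k::field) nc_poly" where
  "D8 i = word_poly [C i, Cinv i] - 1"

definition D :: "nat \<Rightarrow> (letter, 'k::field) nc_poly set" where
  "D g =
     {D1 g j s | j s. j \<in> {2..2*g} \<and> s \<ge> 1} \<union>
     {D2 g j s | j s. j \<in> {2..2*g} \<and> s \<ge> 1} \<union>
     {D3 g} \<union>
     {D4 g} \<union>
     {D5 g i | i. i \<in> {2..2*g}} \<union>
     {D6 g i | i. i \<in> {2..2*g}} \<union>
     {D7 i | i. i \<in> {1..2*g}} \<union>
     {D8 i | i. i \<in> {1..2*g}}"

end

theory Submission
  imports Defs
begin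

text \<open>
  Put $n = 2g$, $x_i = c_i$ and $x_{n+i} = c_i^{-1}$ with indices modulo $2n$. Then $x_i^{-1} = x_{i+n}$,
  the relator is $x_1 x_2 \cdots x_{2n}$, and its rotations give, for every \<open>i\<close>, the relation
  $x_i \cdots x_{i+n-1} = x_{i+n-1} \cdots x_i$, one side of which is the leading word of one of
  the $D_{(3)}, \ldots, D_{(6,i)}$. All elements of \<open>D\<close> are differences of two words. As in
  van der Waerden's proof of the normal form theorem for free products, the group acts on the words
  that contain no leading word of \<open>D\<close>, in such a way that such a word \<open>w\<close> sends the empty word
  to \<open>w\<close>. The polynomials acting as zero on the linear span of these words form an ideal that
  contains the ideal of the group. An arbitrary word sends the empty word to a word that is not larger
  than itself; hence in a nonzero polynomial whose leading word is irreducible nothing can cancel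
  the contribution of that leading word, and the leading word of a nonzero element of the ideal is
  reducible.
\<close>

section \<open>Ideals of the free algebra\<close>

text \<open>The infinite families come from moves that are not decreasing. A letter $c_j$ with j
  \<ge> 2 begins the smaller side of both relations that start with it, so neither relation
  justifies moving it to the right. Yet several such moves in a row may bring it to its inverse, and
  then the word becomes shorter. The action can therefore not decide locally: before $x_i$ is moved
  past a block of n - 1 letters, it has to look ahead through any number of further blocks for its
  inverse. This is what \<open>shortens\<close> expresses and what the recursion of
  \<open>act\<close> carries out. Once the action is there, overlaps of leading words are not
  compared pairwise. What has to be checked is that $x_i$ and $x_{i+n}$ act as mutually inverse maps
  and that the two sides of one relation act alike. Letters enter only through their position on a
  circle of 2n places, a direction, and the knowledge of which side is leading, so that one argument
  covers all rotations and the reversal of the relator.\<close>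

lemma word_poly_append: "word_poly (u @ v) = (word_poly u * word_poly v :: ('x, 'k::field) nc_poly)"
  by (simp add: word_poly_def mult_single plus_list_def)

lemma word_poly_Nil: "word_poly [] = (1 :: ('x, 'k::field) nc_poly)"
  by (simp add: word_poly_def single_one flip: zero_list_def)

lemma word_poly_diff_context:
  "word_poly \<gamma> * (word_poly u - word_poly v) * word_poly \<delta>
     = (word_poly (\<gamma> @ u @ \<delta>) - word_poly (\<gamma> @ v @ \<delta>) :: ('x, 'k::field) nc_poly)"
  by (simp add: word_poly_append algebra_simps)

lemma carrier_free_algebra: "f \<in> carrier (free_algebra X) \<longleftrightarrow> Poly_Mapping.keys f \<subseteq> lists X"
  by (simp add: free_algebra_def)

lemma free_algebra_ops [simp]:
  "f \<otimes>\<^bsub>free_algebra X\<^esub> h = f * h" "f \<oplus>\<^bsub>free_algebra X\<^esub> h = f + h"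
  "\<one>\<^bsub>free_algebra X\<^esub> = 1" "\<zero>\<^bsub>free_algebra X\<^esub> = 0"
  by (simp_all add: free_algebra_def)

lemma keys_mult_lists:
  fixes f h :: "('x, 'k::field) nc_poly"
  assumes "Poly_Mapping.keys f \<subseteq> lists X" "Poly_Mapping.keys h \<subseteq> lists X"
  shows "Poly_Mapping.keys (f * h) \<subseteq> lists X"
  using keys_mult[of f h] assms by (fastforce simp: plus_list_def)

lemma ring_free_algebra: "ring (free_algebra X :: ('x, 'k::field) nc_poly ring)"
proof (rule ringI)
  show "abelian_group (free_algebra X :: ('x, 'k) nc_poly ring)"
  proof (rule abelian_groupI)
    fix f h :: "('x, 'k) nc_poly"
    assume "f \<in> carrier (free_algebra X)" "h \<in> carrier (free_algebra X)"
    then show "f \<oplus>\<^bsub>free_algebra X\<^esub> h \<in> carrier (free_algebra X)"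
      using keys_add[of f h] by (auto simp: carrier_free_algebra)
  next
    fix f :: "('x, 'k) nc_poly"
    assume "f \<in> carrier (free_algebra X)"
    then show "\<exists>h\<in>carrier (free_algebra X). h \<oplus>\<^bsub>free_algebra X\<^esub> f = \<zero>\<^bsub>free_algebra X\<^esub>"
      by (intro bexI[of _ "- f"]) (simp_all add: carrier_free_algebra)
  qed (simp_all add: carrier_free_algebra algebra_simps)
  show "Group.monoid (free_algebra X :: ('x, 'k) nc_poly ring)"
    by (rule monoidI)
      (simp_all add: carrier_free_algebra keys_mult_lists mult.assoc zero_list_def)
qed (simp_all add: algebra_simps)

lemma word_poly_diff_carrier:
  assumes "u \<in> lists X" "v \<in> lists X"
  shows "(word_poly u - word_poly v :: ('x, 'k::field) nc_poly) \<in> carrier (free_algebra X)"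
  using keys_diff[of "word_poly u :: ('x, 'k) nc_poly" "word_poly v"] assms
  by (auto simp: carrier_free_algebra word_poly_def)

locale free_algebra_ideal =
  fixes X :: "'x set" and I :: "('x, 'k::field) nc_poly set"
  assumes ideal_I: "ideal I (free_algebra X)"
begin

sublocale ideal I "free_algebra X"
  by (rule ideal_I)

lemma mult_mem: "f \<in> I \<Longrightarrow> Poly_Mapping.keys p \<subseteq> lists X \<Longrightarrow> Poly_Mapping.keys q \<subseteq> lists X \<Longrightarrow> p * f * q \<in> I"
  using I_l_closed[of f p] I_r_closed[of "p * f" q] by (simp add: carrier_free_algebra)

lemma add_mem: "f \<in> I \<Longrightarrow> h \<in> I \<Longrightarrow> f + h \<in> I"
  using additive_subgroup.a_closed[OF is_additive_subgroup] by simp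

lemma zero_mem: "0 \<in> I"
  using additive_subgroup.zero_closed[OF is_additive_subgroup] by simp

lemma minus_mem: "f \<in> I \<Longrightarrow> - f \<in> I"
  using mult_mem[of f "- 1" 1] by (simp add: zero_list_def)

lemma diff_mem: "f \<in> I \<Longrightarrow> h \<in> I \<Longrightarrow> f - h \<in> I"
  using add_mem[of f "- h"] minus_mem[of h] by simp

definition word_cong :: "'x list \<Rightarrow> 'x list \<Rightarrow> bool" where
  "word_cong u v \<longleftrightarrow> word_poly u - word_poly v \<in> I"

lemma word_cong_refl [simp]: "word_cong u u"
  using zero_mem by (simp add: word_cong_def)

lemma word_cong_sym: "word_cong u v \<Longrightarrow> word_cong v u"
  using minus_mem[of "word_poly u - word_poly v"] by (simp add: word_cong_def)

lemma word_cong_trans [trans]: "word_cong u v \<Longrightarrow> word_cong v w \<Longrightarrow> word_cong u w"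
  using add_mem[of "word_poly u - word_poly v" "word_poly v - word_poly w"] by (simp add: word_cong_def)

lemma word_cong_context:
  assumes "word_cong u v" "p \<in> lists X" "q \<in> lists X"
  shows "word_cong (p @ u @ q) (p @ v @ q)"
  using mult_mem[of "word_poly u - word_poly v" "word_poly p" "word_poly q"] assms
  by (simp add: word_cong_def word_poly_diff_context) (simp add: word_poly_def)

end

section \<open>Annihilators of actions of words\<close>

lemma poly_mapping_sum_singles: "(\<Sum>v\<in>Poly_Mapping.keys f. Poly_Mapping.single v (Poly_Mapping.lookup f v)) = f"
  for f :: "'a \<Rightarrow>\<^sub>0 'b::comm_monoid_add"
proof (rule poly_mapping_eqI)
  fix w
  show "Poly_Mapping.lookup (\<Sum>v\<in>Poly_Mapping.keys f. Poly_Mapping.single v (Poly_Mapping.lookup f v)) w = Poly_Mapping.lookup f w"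
    by (simp add: lookup_sum lookup_single when_def in_keys_iff)
qed

locale word_action =
  fixes X :: "'x set" and S :: "'s set" and act :: "'x \<Rightarrow> 's \<Rightarrow> 's"
  assumes bij_act: "a \<in> X \<Longrightarrow> bij_betw (act a) S S"
begin

lemma bij_word: "w \<in> lists X \<Longrightarrow> bij_betw (foldr act w) S S"
proof (induction w)
  case (Cons a w)
  then show ?case using bij_betw_trans[of "foldr act w" S S "act a" S] bij_act
    by (auto simp: comp_def)
qed (auto simp: bij_betw_def inj_on_def)

text \<open>\<open>coeff z u f\<close> is the coefficient of \<open>u\<close> in the result of applying \<open>f\<close> to \<open>z\<close>.\<close>

definition coeff :: "'s \<Rightarrow> 's \<Rightarrow> ('x, 'k::field) nc_poly \<Rightarrow> 'k" where
  "coeff z u f = (\<Sum>v\<in>Poly_Mapping.keys f. if foldr act v z = u then Poly_Mapping.lookup f v else 0)"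

lemma coeff_superset:
  assumes "finite V" "Poly_Mapping.keys f \<subseteq> V"
  shows "coeff z u f = (\<Sum>v\<in>V. if foldr act v z = u then Poly_Mapping.lookup f v else 0)"
  unfolding coeff_def using assms by (intro sum.mono_neutral_left) (auto simp: in_keys_iff)

lemma coeff_add: "coeff z u (f + h) = coeff z u f + coeff z u h"
proof -
  have "finite (Poly_Mapping.keys f \<union> Poly_Mapping.keys h)" by simp
  note * = coeff_superset[OF this, of _ z u]
  show ?thesis using keys_add[of f h]
    by (simp add: * flip: sum.distrib) (intro sum.cong, auto simp: lookup_add)
qed

lemma coeff_0 [simp]: "coeff z u 0 = 0"
  by (simp add: coeff_def)

lemma coeff_sum: "coeff z u (sum F V) = (\<Sum>v\<in>V. coeff z u (F v))"
  by (induction V rule: infinite_finite_induct) (simp_all add: coeff_add)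

lemma coeff_single: "coeff z u (Poly_Mapping.single v c) = (if foldr act v z = u then c else 0)"
  by (simp add: coeff_def)

text \<open>Vanishing matrix coefficients express that \<open>f\<close> acts as zero on the linear
  span of \<open>S\<close>, without constructing that space.\<close>

definition annihilator :: "('x, 'k::field) nc_poly set" where
  "annihilator = {f \<in> carrier (free_algebra X). \<forall>z\<in>S. \<forall>u\<in>S. coeff z u f = 0}"

text \<open>Since the word \<open>a\<close> permutes \<open>S\<close>, the coefficient of
  \<open>u\<close> after \<open>a\<close> times \<open>f\<close> is, up to a scalar, the coefficient
  of the preimage of \<open>u\<close> after \<open>f\<close>. Bijectivity of the letters is assumed
  for this purpose.\<close>

lemma coeff_left_mult:
  fixes f :: "('x, 'k::field) nc_poly"
  assumes f: "f \<in> annihilator" and p: "p \<in> carrier (free_algebra X)" and z: "z \<in> S" "u \<in> S"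
  shows "coeff z u (p * f) = 0"
proof -
  have "coeff z u (Poly_Mapping.single a c * f) = 0" if a: "a \<in> lists X" for a c
  proof -
    obtain t where t: "t \<in> S" "foldr act a t = u"
      using bij_word[OF a] z(2) unfolding bij_betw_def by (metis imageE)
    have iff: "foldr act (a @ v) z = u \<longleftrightarrow> foldr act v z = t" if "v \<in> Poly_Mapping.keys f" for v
    proof -
      have "v \<in> lists X" using f that by (auto simp: annihilator_def carrier_free_algebra)
      then have "foldr act v z \<in> S" using bij_word z(1) bij_betwE by blast
      then show ?thesis
        using inj_on_eq_iff[OF bij_betw_imp_inj_on[OF bij_word[OF a]], of _ t] t by fastforce
    qed
    have "Poly_Mapping.single a c * f
        = (\<Sum>v\<in>Poly_Mapping.keys f. Poly_Mapping.single (a @ v) (c * Poly_Mapping.lookup f v))"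
      using arg_cong[OF poly_mapping_sum_singles[of f], of "(*) (Poly_Mapping.single a c)"]
      by (simp only: sum_distrib_left mult_single plus_list_def)
    then have "coeff z u (Poly_Mapping.single a c * f)
        = (\<Sum>v\<in>Poly_Mapping.keys f. if foldr act (a @ v) z = u then c * Poly_Mapping.lookup f v else 0)"
      by (simp only: coeff_sum coeff_single)
    also have "\<dots> = c * coeff z t f"
      unfolding coeff_def sum_distrib_left by (intro sum.cong refl) (simp only: iff, simp)
    also have "\<dots> = 0" using f t z by (simp add: annihilator_def)
    finally show ?thesis .
  qed
  moreover have "p * f = (\<Sum>a\<in>Poly_Mapping.keys p. Poly_Mapping.single a (Poly_Mapping.lookup p a) * f)"
    by (simp only: poly_mapping_sum_singles flip: sum_distrib_right)
  ultimately show ?thesis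
    using p by (simp only: coeff_sum) (intro sum.neutral, auto simp: carrier_free_algebra)
qed

text \<open>Right multiplication by \<open>a\<close> moves the starting point from \<open>z\<close>
  to \<open>foldr act a z\<close>; this is why \<open>annihilator\<close> quantifies over all
  starting points.\<close>

lemma coeff_right_mult:
  fixes f :: "('x, 'k::field) nc_poly"
  assumes f: "f \<in> annihilator" and p: "p \<in> carrier (free_algebra X)" and z: "z \<in> S" "u \<in> S"
  shows "coeff z u (f * p) = 0"
proof -
  have "coeff z u (f * Poly_Mapping.single a c) = 0" if a: "a \<in> lists X" for a c
  proof -
    have "f * Poly_Mapping.single a c
        = (\<Sum>v\<in>Poly_Mapping.keys f. Poly_Mapping.single (v @ a) (Poly_Mapping.lookup f v * c))"
      using arg_cong[OF poly_mapping_sum_singles[of f], of "\<lambda>h. h * Poly_Mapping.single a c"]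
      by (simp only: sum_distrib_right mult_single plus_list_def)
    then have "coeff z u (f * Poly_Mapping.single a c)
        = (\<Sum>v\<in>Poly_Mapping.keys f. if foldr act (v @ a) z = u then Poly_Mapping.lookup f v * c else 0)"
      by (simp only: coeff_sum coeff_single)
    also have "\<dots> = coeff (foldr act a z) u f * c"
      unfolding coeff_def sum_distrib_right by (intro sum.cong refl) simp
    also have "\<dots> = 0"
      using f z bij_betwE[OF bij_word[OF a]] by (simp add: annihilator_def)
    finally show ?thesis .
  qed
  moreover have "f * p = (\<Sum>a\<in>Poly_Mapping.keys p. f * Poly_Mapping.single a (Poly_Mapping.lookup p a))"
    by (simp only: poly_mapping_sum_singles flip: sum_distrib_left)
  ultimately show ?thesis
    using p by (simp only: coeff_sum) (intro sum.neutral, auto simp: carrier_free_algebra)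
qed

lemma ideal_annihilator: "ideal (annihilator :: ('x, 'k::field) nc_poly set) (free_algebra X)"
proof (rule idealI)
  interpret ring "free_algebra X :: ('x, 'k) nc_poly ring" by (rule ring_free_algebra)
  show "ring (free_algebra X :: ('x, 'k) nc_poly ring)" by (rule ring_free_algebra)
  have uminus: "- f \<in> annihilator" if "f \<in> annihilator" for f :: "('x, 'k) nc_poly"
    using that coeff_left_mult[OF that, of "- 1"]
    by (auto simp: annihilator_def carrier_free_algebra zero_list_def)
  show "subgroup (annihilator :: ('x, 'k) nc_poly set) (add_monoid (free_algebra X))"
  proof (rule add.subgroupI)
    fix f h :: "('x, 'k) nc_poly"
    assume *: "f \<in> annihilator" "h \<in> annihilator"
    then show "f \<oplus>\<^bsub>free_algebra X\<^esub> h \<in> annihilator"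
      using keys_add[of f h] by (simp add: annihilator_def coeff_add carrier_free_algebra) blast
    have "\<ominus>\<^bsub>free_algebra X\<^esub> f = - f"
      using uminus[OF *(1)] *(1) by (intro minus_equality) (auto simp: annihilator_def)
    then show "\<ominus>\<^bsub>free_algebra X\<^esub> f \<in> annihilator" using uminus[OF *(1)] by simp
  next
    have "(0 :: ('x, 'k) nc_poly) \<in> annihilator"
      by (simp add: annihilator_def carrier_free_algebra)
    then show "(annihilator :: ('x, 'k) nc_poly set) \<noteq> {}" by blast
  qed (auto simp: annihilator_def)
  fix f p :: "('x, 'k) nc_poly"
  assume *: "f \<in> annihilator" "p \<in> carrier (free_algebra X)"
  then have "f \<in> carrier (free_algebra X)" by (simp add: annihilator_def)
  with * have "p * f \<in> carrier (free_algebra X)" "f * p \<in> carrier (free_algebra X)"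
    by (auto simp: carrier_free_algebra keys_mult_lists)
  then show "p \<otimes>\<^bsub>free_algebra X\<^esub> f \<in> annihilator" "f \<otimes>\<^bsub>free_algebra X\<^esub> p \<in> annihilator"
    using coeff_left_mult[OF *] coeff_right_mult[OF *] by (auto simp: annihilator_def)
qed

lemma word_diff_annihilator:
  assumes "u \<in> lists X" "v \<in> lists X" "\<And>z. z \<in> S \<Longrightarrow> foldr act u z = foldr act v z"
  shows "(word_poly u - word_poly v :: ('x, 'k::field) nc_poly) \<in> annihilator"
proof -
  have "(word_poly u - word_poly v :: ('x, 'k) nc_poly)
      = Poly_Mapping.single u 1 + Poly_Mapping.single v (- 1)"
    by (simp add: word_poly_def single_uminus)
  then have "coeff z w (word_poly u - word_poly v :: ('x, 'k) nc_poly) = 0"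
    if "z \<in> S" for z w
    using assms(3)[OF that] by (simp only: coeff_add coeff_single) simp
  then show ?thesis
    using word_poly_diff_carrier[OF assms(1,2)] by (simp only: annihilator_def) blast
qed

end

section \<open>Sets of binomials\<close>

locale admissible_order =
  fixes r :: "('x list \<times> 'x list) set"
  assumes trans_r: "trans r" and irrefl_r: "(w, w) \<notin> r" and total_r: "total r"
    and append_r: "(u, v) \<in> r \<Longrightarrow> (p @ u @ q, p @ v @ q) \<in> r"
begin

lemma leading_word_eq:
  assumes "w \<in> Poly_Mapping.keys f" "\<And>v. v \<in> Poly_Mapping.keys f \<Longrightarrow> v \<noteq> w \<Longrightarrow> (v, w) \<in> r"
  shows "leading_word r f = w"
  unfolding leading_word_def
proof (rule the_equality)
  fix v
  assume "v \<in> Poly_Mapping.keys f \<and> (\<forall>x\<in>Poly_Mapping.keys f. x \<noteq> v \<longrightarrow> (x, v) \<in> r)"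
  then show "v = w" using assms transD[OF trans_r, of v w v] irrefl_r by metis
qed (use assms in blast)

lemma finite_greatest:
  assumes "finite A" "A \<noteq> {}"
  shows "\<exists>w\<in>A. \<forall>v\<in>A. v \<noteq> w \<longrightarrow> (v, w) \<in> r"
  using assms
proof (induction rule: finite_ne_induct)
  case (insert x F)
  then obtain w where w: "w \<in> F" "\<forall>v\<in>F. v \<noteq> w \<longrightarrow> (v, w) \<in> r" by blast
  have "(x, w) \<in> r \<or> (w, x) \<in> r"
    using insert w total_r unfolding total_on_def by (metis UNIV_I)
  then show ?case
  proof
    assume "(w, x) \<in> r"
    then have "(v, x) \<in> r" if "v \<in> F" for v using w that transD[OF trans_r, of v w x] by metis
    then show ?thesis by blast
  qed (use w in blast)
qed simp

lemma leading_word: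
  assumes "f \<noteq> 0"
  shows "leading_word r f \<in> Poly_Mapping.keys f" "v \<in> Poly_Mapping.keys f \<Longrightarrow> v \<noteq> leading_word r f \<Longrightarrow> (v, leading_word r f) \<in> r"
proof -
  obtain w where w: "w \<in> Poly_Mapping.keys f" "\<forall>v\<in>Poly_Mapping.keys f. v \<noteq> w \<longrightarrow> (v, w) \<in> r"
    using finite_greatest[of "Poly_Mapping.keys f"] assms by auto
  then have "leading_word r f = w" by (intro leading_word_eq) auto
  then show "leading_word r f \<in> Poly_Mapping.keys f"
    "v \<in> Poly_Mapping.keys f \<Longrightarrow> v \<noteq> leading_word r f \<Longrightarrow> (v, leading_word r f) \<in> r"
    using w by auto
qed

lemma leading_word_lists: "f \<in> carrier (free_algebra X) \<Longrightarrow> f \<noteq> 0 \<Longrightarrow> leading_word r f \<in> lists X"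
  using leading_word(1) unfolding carrier_free_algebra by blast

lemma binomial:
  assumes "(v, u) \<in> r"
  shows "word_poly u - word_poly v \<noteq> (0 :: ('x, 'k::field) nc_poly)"
    and "leading_word r (word_poly u - word_poly v :: ('x, 'k) nc_poly) = u"
    and "leading_coeff r (word_poly u - word_poly v :: ('x, 'k) nc_poly) = 1"
proof -
  let ?f = "word_poly u - word_poly v :: ('x, 'k) nc_poly"
  have "u \<noteq> v" using assms irrefl_r by auto
  then have l: "Poly_Mapping.lookup ?f u = 1"
    by (simp add: word_poly_def lookup_minus lookup_single)
  moreover have "Poly_Mapping.keys ?f \<subseteq> {u, v}"
    using keys_diff[of "word_poly u :: ('x, 'k) nc_poly" "word_poly v"] by (auto simp: word_poly_def)
  ultimately show "leading_word r ?f = u"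
    by (intro leading_word_eq) (use assms in \<open>auto simp: in_keys_iff\<close>)
  then show "leading_coeff r ?f = 1" using l by (simp add: leading_coeff_def)
  show "?f \<noteq> 0" using l by auto
qed

lemma const_poly_word: "const_poly c * word_poly u = (Poly_Mapping.single u c :: ('x, 'k::field) nc_poly)"
  by (simp add: const_poly_def word_poly_def mult_single plus_list_def)

text \<open>The step trades the leading word \<gamma>u\<delta> for \<gamma>v\<delta>, which is
  smaller because the order is compatible with concatenation. All other words of \<open>f\<close>
  were smaller already, so the leading word drops; this is the measure for termination.\<close>

lemma reduces_binomial:
  fixes f :: "('x, 'k::field) nc_poly"
  assumes f: "f \<noteq> 0" and r: "(v, u) \<in> r" and lw: "leading_word r f = \<gamma> @ u @ \<delta>"
  obtains f' where "reduces r (word_poly u - word_poly v) f f'"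
    "f' \<noteq> 0 \<Longrightarrow> (leading_word r f', leading_word r f) \<in> r"
proof -
  let ?c = "leading_coeff r f" and ?w = "\<gamma> @ u @ \<delta>" and ?w' = "\<gamma> @ v @ \<delta>"
  let ?f = "f - const_poly (?c / leading_coeff r (word_poly u - word_poly v :: ('x, 'k) nc_poly))
              * (word_poly \<gamma> * (word_poly u - word_poly v) * word_poly \<delta>)"
  have eq: "?f = f - Poly_Mapping.single ?w ?c + Poly_Mapping.single ?w' ?c"
    unfolding binomial(3)[OF r] word_poly_diff_context by (simp add: right_diff_distrib const_poly_word)
  have red: "reduces r (word_poly u - word_poly v) f ?f"
    unfolding reduces_def using f lw binomial(1)[OF r]
    by (intro conjI exI[of _ \<gamma>] exI[of _ \<delta>]) (simp_all only: binomial(2)[OF r] simp_thms)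
  have w': "(?w', ?w) \<in> r" using append_r[OF r] .
  then have neq: "?w' \<noteq> ?w" using irrefl_r by auto
  have "Poly_Mapping.lookup ?f ?w = 0"
    using neq lw unfolding eq
    by (simp add: lookup_add lookup_minus lookup_single leading_coeff_def)
  moreover have "Poly_Mapping.keys ?f \<subseteq> insert ?w' (insert ?w (Poly_Mapping.keys f))"
    unfolding eq by (auto simp: lookup_add lookup_minus lookup_single in_keys_iff when_def split: if_splits)
  ultimately have sub: "Poly_Mapping.keys ?f \<subseteq> insert ?w' (Poly_Mapping.keys f - {?w})"
    by (auto simp: in_keys_iff)
  show thesis
  proof (rule that[OF red])
    assume "?f \<noteq> 0"
    then have "leading_word r ?f \<in> insert ?w' (Poly_Mapping.keys f - {?w})"
      using sub leading_word(1) by blast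
    then show "(leading_word r ?f, leading_word r f) \<in> r"
      using w' leading_word(2)[OF f] lw by auto
  qed
qed

text \<open>A reduction subtracts an element of \<open>I\<close>, so membership in \<open>I\<close>
  is preserved in both directions, and by \<open>red\<close> a reduction is possible as long as the
  element of \<open>I\<close> is nonzero. Leading words decrease, hence the process ends, and it can
  end only in 0.\<close>

lemma groebner_shirshov_basis_binomials:
  fixes I :: "('x, 'k::field) nc_poly set"
  assumes rules: "\<And>u v. (u, v) \<in> R \<Longrightarrow> u \<in> lists X \<and> v \<in> lists X \<and> (v, u) \<in> r"
    and wf: "wf (r \<inter> lists X \<times> lists X)"
    and I: "genideal (free_algebra X) {word_poly u - word_poly v | u v. (u, v) \<in> R} = I"
    and red: "\<And>f. f \<in> I \<Longrightarrow> f \<noteq> 0 \<Longrightarrow> \<exists>\<gamma> u v \<delta>. (u, v) \<in> R \<and> leading_word r f = \<gamma> @ u @ \<delta>"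
  shows "groebner_shirshov_basis X r {word_poly u - word_poly v | u v. (u, v) \<in> R} I"
proof -
  let ?B = "{word_poly u - word_poly v | u v. (u, v) \<in> R} :: ('x, 'k) nc_poly set"
  have B: "?B \<subseteq> carrier (free_algebra X)" 
  proof
    fix b
    assume "b \<in> ?B"
    then obtain u v where "(u, v) \<in> R" "b = word_poly u - word_poly v" by blast
    then show "b \<in> carrier (free_algebra X)" using rules word_poly_diff_carrier by metis
  qed
  interpret R: ring "free_algebra X :: ('x, 'k) nc_poly ring" by (rule ring_free_algebra)
  interpret free_algebra_ideal X I
    by (rule free_algebra_ideal.intro) (use R.genideal_ideal[OF B] I in simp)
  have BI: "?B \<subseteq> I" using R.genideal_self[OF B] I by simp
  have step_mem: "f' \<in> carrier (free_algebra X) \<and> (f' \<in> I \<longleftrightarrow> f \<in> I)"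
    if f: "f \<in> carrier (free_algebra X)" and b: "b \<in> ?B" and fr: "reduces r b f f'" for b f f'
  proof -
    obtain \<gamma> \<delta> where lw: "leading_word r f = \<gamma> @ leading_word r b @ \<delta>" and "f \<noteq> 0"
      and f': "f' = f - const_poly (leading_coeff r f / leading_coeff r b)
          * (word_poly \<gamma> * b * word_poly \<delta>)" (is "f' = f - ?h")
      using fr unfolding reduces_def by blast
    then have "leading_word r f \<in> lists X"
      using f leading_word_lists by blast
    then have "\<gamma> \<in> lists X" "\<delta> \<in> lists X" using lw by auto
    moreover have "b \<in> I" using b BI by blast
    ultimately have "word_poly \<gamma> * b * word_poly \<delta> \<in> I"
      by (intro mult_mem) (auto simp: word_poly_def)
    then have h: "?h \<in> I"
      using mult_mem[of _ "const_poly _" 1] by (auto simp: const_poly_def zero_list_def)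
    then have "?h \<in> carrier (free_algebra X)" using a_subset by blast
    then have "f' \<in> carrier (free_algebra X)"
      using f keys_diff[of f ?h] f' by (auto simp: carrier_free_algebra)
    moreover have "f' \<in> I \<longleftrightarrow> f \<in> I"
      using diff_mem[of f ?h] add_mem[of f' ?h] h f' by auto
    ultimately show ?thesis by blast
  qed
  have "f \<in> I" if "set_reduces r ?B f h" "h = 0" "f \<in> carrier (free_algebra X)" for f h
    using that unfolding set_reduces_def
  proof (induction rule: converse_rtranclp_induct)
    case base
    then show ?case using zero_mem by simp
  next
    case (step f f')
    then obtain b where "b \<in> ?B" "reduces r b f f'" by blast
    from step_mem[OF step.prems(2) this] show ?case using step.IH step.prems(1) by blast
  qed
  \<comment> \<open>The induction is on the leading word. For \<open>f = 0\<close> that word is an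
    unspecified value of \<open>THE\<close>, so this case is settled separately without looking at
    it.\<close>
  moreover have "set_reduces r ?B f 0" if "f \<in> I" "leading_word r f = w" for f w
    using wf that
  proof (induction w arbitrary: f rule: wf_induct_rule)
    case (less w)
    have fc: "f \<in> carrier (free_algebra X)" using less.prems a_subset by blast
    show ?case
    proof (cases "f = 0")
      case True
      then show ?thesis by (simp add: set_reduces_def)
    next
      case False
      obtain \<gamma> u v \<delta> where uv: "(u, v) \<in> R" and lw: "leading_word r f = \<gamma> @ u @ \<delta>"
        using red[OF less.prems(1) False] by blast
      have "(v, u) \<in> r" using rules uv by blast
      from reduces_binomial[OF False this lw] obtain f'
        where f': "reduces r (word_poly u - word_poly v) f f'"
          "f' \<noteq> 0 \<Longrightarrow> (leading_word r f', leading_word r f) \<in> r" by blast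
      have b: "word_poly u - word_poly v \<in> ?B" using uv by blast
      note * = step_mem[OF fc b f'(1)]
      have "set_reduces r ?B f' 0"
      proof (cases "f' = 0")
        case True
        then show ?thesis by (simp add: set_reduces_def)
      next
        case f'0: False
        have "leading_word r f \<in> lists X" "leading_word r f' \<in> lists X"
          using * fc leading_word_lists False f'0 by blast+
        then show ?thesis using less f'(2)[OF f'0] * by blast
      qed
      then show ?thesis
        unfolding set_reduces_def using b f'(1) by (blast intro: converse_rtranclp_into_rtranclp)
    qed
  qed
  ultimately show ?thesis
    unfolding groebner_shirshov_basis_def using B I by blast
qed

end

section \<open>The action on irreducible words\<close>

text \<open>
  \<open>X i\<close> is $x_i$, and \<open>e\<close> is a direction, \<open>1\<close> for increasing and \<open>-1\<close> for decreasing indices.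
  \<open>big e (X i)\<close> says that, of the two sides of the relation between
  $x_i x_{i+e} \cdots x_{i+e(n-1)}$ and its reversal, the former is the leading word.
\<close>

locale cyclic_relator =
  fixes n :: nat and X :: "int \<Rightarrow> 'a" and big :: "int \<Rightarrow> 'a \<Rightarrow> bool"
  assumes n_ge: "4 \<le> n"
    and X_eq_iff: "X a = X b \<longleftrightarrow> 2 * int n dvd a - b"
    and big_iff: "\<bar>e\<bar> = 1 \<Longrightarrow> big e (X i) \<longleftrightarrow> \<not> big (- e) (X (i + e * (int n - 1)))"
begin

lemma X_neq: "a \<noteq> b \<Longrightarrow> \<bar>a - b\<bar> < 2 * int n \<Longrightarrow> X a \<noteq> X b"
  using zdvd_imp_le[of "2 * int n" "\<bar>a - b\<bar>"] by (auto simp: X_eq_iff)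

lemma sign_cases: "\<bar>e::int\<bar> = 1 \<Longrightarrow> e = 1 \<or> e = -1"
  by linarith

section \<open>Runs of consecutive letters on the circle\<close>

definition run :: "int \<Rightarrow> int \<Rightarrow> nat \<Rightarrow> 'a list" where
  "run e i m = map (\<lambda>k. X (i + e * int k)) [0..<m]"

lemma length_run [simp]: "length (run e i m) = m"
  by (simp add: run_def)

lemma run_0 [simp]: "run e i 0 = []"
  by (simp add: run_def)

lemma run_add: "run e i (m + m') = run e i m @ run e (i + e * int m) m'"
  by (rule nth_equalityI) (auto simp: run_def nth_append algebra_simps)

lemma run_Suc: "run e i (Suc m) = X i # run e (i + e) m"
  using run_add[of e i 1 m] by (simp add: run_def)

lemma run_Suc_last: "run e i (Suc m) = run e i m @ [X (i + e * int m)]"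
  by (simp add: run_def)

lemma run_cong: "X i = X j \<Longrightarrow> run e i m = run e j m"
  by (auto simp: run_def X_eq_iff)

text \<open>One side of the relation without its first letter \<open>X i\<close>: these are the
  letters strictly between \<open>X i\<close> and its inverse \<open>X (i + n)\<close> on one of the
  two arcs of the circle.\<close>

definition tail :: "int \<Rightarrow> int \<Rightarrow> 'a list" where
  "tail e i = run e (i + e) (n - 1)"

lemma tail_cong: "X i = X j \<Longrightarrow> tail e i = tail e j"
  unfolding tail_def by (rule run_cong) (simp add: X_eq_iff)

lemma length_tail [simp]: "length (tail e i) = n - 1"
  by (simp add: tail_def)

lemma tail_Cons: "tail e i = X (i + e) # run e (i + 2 * e) (n - 2)"
proof -
  have "n - 1 = Suc (n - 2)" using n_ge by simp
  then show ?thesis unfolding tail_def by (simp add: run_Suc algebra_simps)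
qed

lemma tail_snoc:
  assumes "\<bar>e\<bar> = 1"
  shows "tail e i = run e (i + e) (n - 2) @ [X (i + int n - e)]"
proof -
  have *: "n - 1 = Suc (n - 2)" using n_ge by simp
  have "X (i + e + e * int (n - 2)) = X (i + int n - e)"
    using sign_cases[OF assms] n_ge by (auto simp: X_eq_iff of_nat_diff)
  then show ?thesis unfolding tail_def * run_Suc_last by simp
qed

text \<open>The inverse of \<open>X i\<close> is the letter that continues the run. A tail followed
  by it is thus a complete side of the relation, starting one position later; this overlap between
  cancelling and turning recurs throughout.\<close>

lemma tail_rotate:
  assumes "\<bar>e\<bar> = 1"
  shows "tail e i @ X (i + int n) # z = X (i + e) # tail e (i + e) @ z"
proof -
  have *: "n - 1 = Suc (n - 2)" using n_ge by simp
  have "X (i + e + e + e * int (n - 2)) = X (i + int n)"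
    using sign_cases[OF assms] n_ge by (auto simp: X_eq_iff of_nat_diff)
  then have "tail e (i + e) = run e (i + 2 * e) (n - 2) @ [X (i + int n)]"
    unfolding tail_def * run_Suc_last by (simp add: algebra_simps)
  then show ?thesis by (simp add: tail_Cons)
qed

lemma tail_append_eqD:
  assumes "\<bar>e\<bar> = 1" "\<bar>f\<bar> = 1" "tail e i @ v = tail f i @ w"
  shows "e = f \<and> v = w"
proof -
  have "X (i + e) = X (i + f)" using assms(3) by (simp add: tail_Cons)
  then have "e = f" using X_neq[of "i + e" "i + f"] assms(1,2) n_ge by force
  then show ?thesis using assms(3) by simp
qed

text \<open>
  With \<open>tail\<close> the relations read \<open>X i # tail e i = tail (- e) (i + n) @ [X i]\<close>. Moving \<open>X i\<close>
  to the right through \<open>s\<close> tails until it meets its inverse accounts for the leading words of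
  $D_{(1,j,s)}$ and $D_{(2,j,s)}$.
\<close>

inductive shortens :: "int \<Rightarrow> 'a list \<Rightarrow> bool" for i where
  cancel: "shortens i (X (i + int n) # w)"
| chain: "\<bar>e\<bar> = 1 \<Longrightarrow> shortens i w \<Longrightarrow> shortens i (tail e i @ w)"

text \<open>The condition for putting \<open>X i\<close> in front of an irreducible word.
  \<open>shortens\<close> admits chains for every letter and with changing directions, which is more
  than the leading words in \<open>D\<close>; \<open>redex\<close> shows that the additional cases
  contain a leading word elsewhere.\<close>

definition ok :: "int \<Rightarrow> 'a list \<Rightarrow> bool" where
  "ok i w \<longleftrightarrow> \<not> shortens i w \<and> (\<forall>e v. \<bar>e\<bar> = 1 \<longrightarrow> big e (X i) \<longrightarrow> w \<noteq> tail e i @ v)"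

lemma tail_neq_cancel: "\<bar>e\<bar> = 1 \<Longrightarrow> tail e i @ v \<noteq> X (i + int n) # w"
  using X_neq[of "i + e" "i + int n"] n_ge by (auto simp: tail_Cons)

lemma shortens_tail [simp]:
  assumes "\<bar>e\<bar> = 1"
  shows "shortens i (tail e i @ w) \<longleftrightarrow> shortens i w"
proof
  assume "shortens i (tail e i @ w)"
  then show "shortens i w"
  proof cases
    case (cancel v)
    then show ?thesis using tail_neq_cancel[OF assms] by blast
  next
    case (chain f v)
    then show ?thesis using tail_append_eqD[OF assms chain(2,1)] by simp
  qed
qed (use assms shortens.chain in blast)

lemma okI:
  assumes "\<And>v. w \<noteq> X (i + int n) # v" "\<And>e v. \<bar>e\<bar> = 1 \<Longrightarrow> w \<noteq> tail e i @ v"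
  shows "ok i w"
proof -
  have "\<not> shortens i w"
  proof
    assume "shortens i w"
    then show False by cases (use assms in blast)+
  qed
  then show ?thesis using assms(2) by (simp add: ok_def)
qed

lemma shortens_cong:
  assumes "X i = X j" "shortens i w"
  shows "shortens j w"
  using assms(2)
proof induction
  case (cancel w)
  have "X (i + int n) = X (j + int n)" using assms(1) by (simp add: X_eq_iff)
  then show ?case using shortens.cancel[of j w] by simp
next
  case (chain e w)
  then show ?case using shortens.chain[of e j w] tail_cong[OF assms(1)] by simp
qed

lemma ok_cong: "X i = X j \<Longrightarrow> ok i w \<longleftrightarrow> ok j w"
  using shortens_cong[of i j w] shortens_cong[of j i w] tail_cong[of i j]
  unfolding ok_def by auto

section \<open>Irreducible words\<close>

inductive irred :: "'a list \<Rightarrow> bool" where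
  Nil: "irred []"
| Cons: "irred w \<Longrightarrow> ok i w \<Longrightarrow> irred (X i # w)"

lemma irred_Cons_iff [simp]: "irred (X i # w) \<longleftrightarrow> irred w \<and> ok i w"
proof
  assume "irred (X i # w)"
  then show "irred w \<and> ok i w"
  proof cases
    case (Cons j)
    then show ?thesis using ok_cong[of i j w] by simp
  qed
qed (simp add: irred.Cons)

lemma irred_appendD: "irred (u @ v) \<Longrightarrow> irred v"
  by (induction u) (auto elim: irred.cases)

lemma not_ok_cancel: "X j = X (i + int n) \<Longrightarrow> \<not> ok i (X j # w)"
  using shortens.cancel by (auto simp: ok_def)

text \<open>\<open>tail e i\<close> ends in \<open>X (i + n - e)\<close>, the inverse of
  \<open>X (i - e)\<close>. Since \<open>tail (- e) i\<close> begins with \<open>X (i - e)\<close>,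
  two consecutive tails of \<open>i\<close> in an irreducible word have the same direction.\<close>

lemma irred_tail_no_inverse:
  assumes "\<bar>e\<bar> = 1" "irred (tail e i @ v)"
  shows "v \<noteq> X (i - e) # w"
proof
  assume v: "v = X (i - e) # w"
  have "irred (X (i + int n - e) # X (i - e) # w)"
    using assms(2) irred_appendD[of "run e (i + e) (n - 2)" "X (i + int n - e) # v"]
    unfolding tail_snoc[OF assms(1)] v by simp
  then show False using not_ok_cancel[of "i - e" "i + int n - e"] by (simp add: X_eq_iff)
qed

lemma ok_next:
  assumes f: "\<bar>f\<bar> = 1" and no: "\<And>v. X (i + f) # w \<noteq> tail f i @ v"
  shows "ok i (X (i + f) # w)"
proof (rule okI)
  show "X (i + f) # w \<noteq> X (i + int n) # v" for v
    using X_neq[of "i + f" "i + int n"] f n_ge by auto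
  show "X (i + f) # w \<noteq> tail e i @ v" if e: "\<bar>e\<bar> = 1" for e v
  proof (cases "e = f")
    case False
    then have "X (i + f) \<noteq> X (i + e)" using X_neq[of "i + f" "i + e"] f e n_ge by auto
    then show ?thesis by (simp add: tail_Cons)
  qed (use no in simp)
qed

text \<open>Only the last letter \<open>X j\<close> of the run is adjacent to \<open>z\<close>. An
  earlier letter sees the beginning of its own tail, which breaks off at \<open>z\<close> because
  \<open>z\<close> does not go on with \<open>X (j + f)\<close>. The bound on \<open>m\<close> keeps
  the run shorter than a full side.\<close>

lemma irred_run_append:
  assumes f: "\<bar>f\<bar> = 1" and z: "irred z" "ok j z" and no: "\<And>v. z \<noteq> X (j + f) # v"
    and m: "m < n - 1"
  shows "irred (run f (j - f * int m) (Suc m) @ z)"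
  using m
proof (induction m)
  case 0
  then show ?case using z by (simp add: run_Suc)
next
  case (Suc m)
  let ?i = "j - f * int (Suc m)"
  have i: "?i + f = j - f * int m" by (simp add: algebra_simps)
  have "ok ?i (run f (?i + f) (Suc m) @ z)"
    unfolding run_Suc append_Cons
  proof (rule ok_next[OF f])
    fix v
    \<comment> \<open>The tail is longer than the \<open>Suc m\<close> letters that follow
      \<open>X ?i\<close> in the run, so its next letter would have to be
      \<open>X (j + f)\<close>.\<close>
    have *: "n - 1 = Suc m + Suc (n - 3 - m)" using Suc.prems by simp
    have "?i + f + f * int (Suc m) = j + f" by (simp add: algebra_simps)
    then have "tail f ?i @ v = run f (?i + f) (Suc m) @ X (j + f) # run f (j + f + f) (n - 3 - m) @ v"
      by (subst tail_def, subst *, subst run_add, subst run_Suc[of f _ "n - 3 - m"]) simp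
    then show "X (?i + f) # run f (?i + f + f) m @ z \<noteq> tail f ?i @ v"
      using no by (simp add: run_Suc)
  qed
  then show ?case
    using Suc by (subst run_Suc) (simp add: i del: of_nat_Suc)
qed

text \<open>\<open>X i\<close> is moved past a tail only when this pays: either the side it begins
  is the leading one, or the move is part of a chain that ends in a cancellation. Otherwise it stays
  in front. The recursion is on all words; irreducibility enters only in the lemmas.\<close>

function act :: "int \<Rightarrow> 'a list \<Rightarrow> 'a list" where
  "act i w =
    (if w \<noteq> [] \<and> hd w = X (i + int n) then tl w
     else if take (n - 1) w = tail 1 i \<and> (big 1 (X i) \<or> shortens i (drop (n - 1) w))
       then tail (-1) (i + int n) @ act i (drop (n - 1) w)
     else if take (n - 1) w = tail (-1) i \<and> (big (-1) (X i) \<or> shortens i (drop (n - 1) w))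
       then tail 1 (i + int n) @ act i (drop (n - 1) w)
     else X i # w)"
  by auto
termination
proof (relation "measure (length \<circ> snd)", goal_cases)
  case (2 i w)
  then have "w \<noteq> []" by (auto simp: tail_Cons)
  then show ?case using n_ge by (cases w) auto
next
  case (3 i w)
  then have "w \<noteq> []" by (auto simp: tail_Cons)
  then show ?case using n_ge by (cases w) auto
qed simp

declare act.simps [simp del]

lemma act_cancel [simp]: "act i (X (i + int n) # w) = w"
  by (subst act.simps) simp

lemma act_chain:
  assumes e: "\<bar>e\<bar> = 1" and "big e (X i) \<or> shortens i v"
  shows "act i (tail e i @ v) = tail (- e) (i + int n) @ act i v"
proof -
  have "hd (tail e i @ v) \<noteq> X (i + int n)"
    using X_neq[of "i + e" "i + int n"] e n_ge by (auto simp: tail_Cons)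
  moreover have "tail (-1) i \<noteq> tail 1 i"
    using tail_append_eqD[of "-1" 1 i "[]" "[]"] by auto
  ultimately show ?thesis
    using sign_cases[OF e] assms(2) by (subst act.simps) auto
qed

lemma act_ok:
  assumes "ok i w"
  shows "act i w = X i # w"
proof -
  have "\<not> (w \<noteq> [] \<and> hd w = X (i + int n))"
    using assms not_ok_cancel[of "i + int n" i "tl w"] by (cases w) auto
  note * = this
  have "\<not> (take (n - 1) w = tail e i \<and> (big e (X i) \<or> shortens i (drop (n - 1) w)))"
    if e: "\<bar>e\<bar> = 1" for e
  proof
    assume *: "take (n - 1) w = tail e i \<and> (big e (X i) \<or> shortens i (drop (n - 1) w))"
    then have "w = tail e i @ drop (n - 1) w" by (metis append_take_drop_id)
    then show False using * e assms shortens_tail[OF e, of i "drop (n - 1) w"] by (metis ok_def)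
  qed
  from * this[of 1] this[of "-1"] show ?thesis by (subst act.simps) auto
qed

lemma not_ok_cases:
  assumes "\<not> ok i w"
  obtains (cancel) v where "w = X (i + int n) # v"
  | (chain) e v where "\<bar>e\<bar> = 1" "w = tail e i @ v" "big e (X i) \<or> shortens i v"
proof (cases "shortens i w")
  case True
  then show thesis by cases (use that in auto)
next
  case False
  then show thesis using assms that(2) by (auto simp: ok_def)
qed

lemma act_induct [case_names cancel chain ok]:
  assumes "\<And>v. P (X (i + int n) # v)"
    and "\<And>e v. \<bar>e\<bar> = 1 \<Longrightarrow> big e (X i) \<or> shortens i v \<Longrightarrow> P v \<Longrightarrow> P (tail e i @ v)"
    and "\<And>w. ok i w \<Longrightarrow> P w"
  shows "P w"
proof (induction w rule: length_induct)
  case (1 w)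
  show ?case
  proof (cases "ok i w")
    case False
    then show ?thesis
    proof (cases rule: not_ok_cases)
      case (chain e v)
      then show ?thesis using 1 assms(2)[of e v] n_ge by simp
    qed (use assms in simp)
  qed (use assms in simp)
qed

section \<open>The action preserves irreducibility and is invertible\<close>

text \<open>The two tails of a turn have equal length, so only the last step counts: a cancellation
  loses one letter, a letter that comes to rest adds one.\<close>

lemma length_act:
  "if shortens i w then Suc (length (act i w)) = length w else length (act i w) = Suc (length w)"
proof (induction w rule: act_induct[of _ i])
  case (cancel v)
  then show ?case using shortens.cancel by simp
next
  case (chain e v)
  then show ?case by (simp add: act_chain split: if_splits)
next
  case (ok w)
  then show ?case by (simp add: act_ok) (simp add: ok_def)
qed

lemma irred_act: "irred w \<Longrightarrow> irred (act i w)"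
proof (induction w rule: act_induct[of _ i])
  case (cancel v)
  then show ?case by simp
next
  case (ok w)
  then show ?case by (simp add: act_ok)
next
  case (chain e v)
  note e = chain(1)
  have v: "irred v" using chain.prems irred_appendD by blast
  have no_inv: "v \<noteq> X (i - e) # w" for w
    using irred_tail_no_inverse[OF e chain.prems] .
  have e': "\<bar>- e\<bar> = 1" using e by simp
  have act: "act i (tail e i @ v) = tail (- e) (i + int n) @ act i v"
    by (rule act_chain) fact+
  \<comment> \<open>The new tail written as a run that ends in \<open>X (i + e)\<close>, the form
    required by \<open>irred_run_append\<close>; the letter that would continue it is
    \<open>X i\<close>.\<close>
  have *: "tail (- e) (i + int n) = run (- e) (i + e - - e * int (n - 2)) (Suc (n - 2))"
    proof -
    have "n - 1 = Suc (n - 2)" using n_ge by simp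
    moreover have "X (i + int n + - e) = X (i + e - - e * int (n - 2))"
      using sign_cases[OF e] n_ge by (auto simp: X_eq_iff of_nat_diff)
    ultimately show ?thesis unfolding tail_def using run_cong by metis
  qed
  have main: "irred (tail (- e) (i + int n) @ z)"
    if "irred z" "ok (i + e) z" "\<And>w. z \<noteq> X i # w" for z
    unfolding * by (rule irred_run_append) (use that e n_ge in auto)
  show ?case
  proof (cases "ok i v")
    case True
    then have big: "big e (X i)" using chain(2) by (auto simp: ok_def)
    have no: "v \<noteq> X (i - e) # w" for w by (rule no_inv)
    \<comment> \<open>\<open>X i\<close> comes to rest in front of \<open>v\<close>, so the result
      is the smaller side of the relation followed by \<open>v\<close>.
      \<open>irred_run_append\<close> covers its last \<open>n - 1\<close> letters, ending in
      \<open>X i\<close>; the first letter \<open>X (i + n - e)\<close> is added separately.\<close>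
    have *: "irred (run (- e) (i - - e * int (n - 2)) (Suc (n - 2)) @ v)"
      by (rule irred_run_append) (use v True no e n_ge in auto)
    have tl: "run (- e) (i - - e * int (n - 2)) (Suc (n - 2)) = tail (- e) (i + int n - e)"
    proof -
      have "n - 1 = Suc (n - 2)" using n_ge by simp
      moreover have "X (i + int n - e + - e) = X (i - - e * int (n - 2))"
        using sign_cases[OF e] n_ge by (auto simp: X_eq_iff of_nat_diff)
      ultimately show ?thesis unfolding tail_def using run_cong by metis
    qed
    let ?k = "i + int n - e"
    \<comment> \<open>\<open>X ?k\<close> is also the last letter of \<open>tail e i\<close>, so
      irreducibility of the argument already excludes that it shortens \<open>v\<close>.\<close>
    have "irred (X ?k # v)"
      using chain.prems irred_appendD[of "run e (i + e) (n - 2)" "X ?k # v"]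
      unfolding tail_snoc[OF e] by simp
    then have "\<not> shortens ?k v" by (auto simp: ok_def)
    have bk: "\<not> big (- e) (X ?k)"
    proof -
      have "X (i + e * (int n - 1)) = X ?k" using sign_cases[OF e] by (auto simp: X_eq_iff)
      then show ?thesis using big_iff[OF e, of i] big by simp
    qed
    have "ok ?k (tail (- e) ?k @ v)"
      unfolding ok_def
    proof (intro conjI allI impI)
      show "\<not> shortens ?k (tail (- e) ?k @ v)" using \<open>\<not> shortens ?k v\<close> e by simp
      show "tail (- e) ?k @ v \<noteq> tail f ?k @ u" if "\<bar>f\<bar> = 1" "big f (X ?k)" for f u
        using tail_append_eqD[OF e' that(1)] that(2) bk by metis
    qed
    then have "irred (X ?k # tail (- e) ?k @ v)" using * tl by simp
    moreover have "X ?k # tail (- e) ?k = tail (- e) (i + int n) @ [X i]"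
    proof -
      have "X ?k # tail (- e) ?k = run (- e) ?k (Suc (n - 1))"
        by (simp only: tail_def run_Suc)
      also have "\<dots> = tail (- e) (i + int n) @ [X (?k + - e * int (n - 1))]"
        unfolding run_Suc_last tail_def by simp
      also have "X (?k + - e * int (n - 1)) = X i"
        using sign_cases[OF e] n_ge by (auto simp: X_eq_iff of_nat_diff)
      finally show ?thesis .
    qed
    ultimately have "irred ((tail (- e) (i + int n) @ [X i]) @ v)"
      by (metis append_Cons)
    then show ?thesis unfolding act act_ok[OF True] by simp
  next
    case False
    then show ?thesis
    proof (cases rule: not_ok_cases)
      case (cancel z)
      \<comment> \<open>Here \<open>X i\<close> meets its inverse. By \<open>tail_rotate\<close> the
        argument reads \<open>X (i + e) # tail e (i + e) @ z\<close>, and its irreducibility gives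
        the condition on \<open>z\<close> at \<open>i + e\<close>.\<close>
      have "irred z" using v cancel by simp
      moreover have "z \<noteq> X i # w" for w
      proof
        assume "z = X i # w"
        then have "ok (i + int n) (X i # w)" using v cancel by simp
        then show False using not_ok_cancel[of i "i + int n"] by (simp add: X_eq_iff)
      qed
      moreover have "ok (i + e) z"
      proof -
        have "tail e i @ X (i + int n) # z = X (i + e) # tail e (i + e) @ z"
          by (rule tail_rotate) fact
        then have "irred (X (i + e) # tail e (i + e) @ z)"
          using chain.prems cancel by metis
        then have "ok (i + e) (tail e (i + e) @ z)" by simp
        then have ns: "\<not> shortens (i + e) z" and nb: "\<not> big e (X (i + e))"
          unfolding ok_def using e by auto
        have "z \<noteq> tail f (i + e) @ u" if f: "\<bar>f\<bar> = 1" "big f (X (i + e))" for f u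
        proof (cases "f = e")
          case False
          then have "f = - e" using e f by linarith
          then show ?thesis using \<open>\<And>w. z \<noteq> X i # w\<close> by (simp add: tail_Cons)
        qed (use nb f in simp)
        then show ?thesis using ns by (auto simp: ok_def)
      qed
      ultimately have "irred (tail (- e) (i + int n) @ z)" using main by blast
      then show ?thesis using act cancel by simp
    next
      case c: (chain f u)
      have "f = e"
      proof (rule ccontr)
        assume "f \<noteq> e"
        then have "f = - e" using e c(1) by linarith
        then show False using no_inv[of "run (- e) (i - 2 * e) (n - 2) @ u"] c(2) by (simp add: tail_Cons)
      qed
      have av: "act i v = tail (- e) (i + int n) @ act i u"
        unfolding c(2) \<open>f = e\<close> using c e by (intro act_chain) (auto simp: \<open>f = e\<close>)
      then have start: "act i v = X (i + int n - e) # run (- e) (i + int n - 2 * e) (n - 2) @ act i u"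
        by (simp add: tail_Cons)
      \<comment> \<open>\<open>act i v\<close> begins with \<open>X (i + n - e)\<close>, which is
        none of the letters that could start a redex after \<open>X (i + e)\<close>. From
        \<open>X (i + 2 * e)\<close> it is \<open>n - 3\<close> or \<open>n + 3\<close> places away,
        and \<open>4 \<le> n\<close> keeps both strictly between 0 and \<open>2 * n\<close>.\<close>
      show ?thesis unfolding act
      proof (rule main)
        show "irred (act i v)" using chain.IH v by simp
        show "act i v \<noteq> X i # w" for w
          using X_neq[of "i + int n - e" i] sign_cases[OF e] n_ge by (auto simp: start)
        show "ok (i + e) (act i v)"
        proof (rule okI)
          show "act i v \<noteq> X (i + e + int n) # w" for w
            using X_neq[of "i + int n - e" "i + e + int n"] sign_cases[OF e] n_ge by (auto simp: start)
          show "act i v \<noteq> tail f (i + e) @ w" if "\<bar>f\<bar> = 1" for f w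
            using X_neq[of "i + int n - e" "i + e + f"] sign_cases[OF e] sign_cases[OF that] n_ge
            by (auto simp: start tail_Cons)
        qed
      qed
    qed
  qed
qed

lemma act_cancel': "X j = X (i + int n) \<Longrightarrow> act i (X j # w) = w"
  by simp

text \<open>All tails of the chain have the direction \<open>e\<close>, and the last one is followed
  by \<open>X (i + n)\<close>. By \<open>tail_rotate\<close> these letters form the side starting at
  \<open>X (i + e)\<close>, which must not be leading in an irreducible word.\<close>

lemma shortens_tail_not_big:
  assumes e: "\<bar>e\<bar> = 1" and "shortens i v" "irred (tail e i @ v)"
  shows "\<not> big e (X (i + e))"
  using assms(2,3)
proof induction
  case (cancel z)
  then have "irred (X (i + e) # tail e (i + e) @ z)" using tail_rotate[OF e] by metis
  then show ?case using e by (auto simp: ok_def)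
next
  case (chain f u)
  have "f = e"
  proof (rule ccontr)
    assume "f \<noteq> e"
    then have "f = - e" using e chain.hyps by linarith
    then show False
      using irred_tail_no_inverse[OF e chain.prems, of "run (- e) (i - 2 * e) (n - 2) @ u"]
      by (simp add: tail_Cons)
  qed
  then show ?case using chain irred_appendD by blast
qed

lemma act_inverse: "irred w \<Longrightarrow> act (i + int n) (act i w) = w"
proof (induction w rule: act_induct[of _ i])
  case (cancel v)
  then show ?case by (simp add: act_ok)
next
  case (ok w)
  then show ?case by (simp add: act_ok act_cancel' X_eq_iff)
next
  case (chain e v)
  note e = chain(1)
  have IH: "act (i + int n) (act i v) = v" using chain irred_appendD by blast
  \<comment> \<open>The condition under which the inverse letter turns the tail back. If
    \<open>X i\<close> was cancelled, the side at \<open>i + e\<close> is not leading, so its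
    reversal, which begins with \<open>X (i + n)\<close>, is. Otherwise \<open>act i v\<close> has
    one letter more than \<open>v\<close>; by \<open>IH\<close> the inverse letter leads back to
    \<open>v\<close>, and by \<open>length_act\<close> losing a letter means shortening.\<close>
  have "big (- e) (X (i + int n)) \<or> shortens (i + int n) (act i v)"
  proof (cases "shortens i v")
    case True
    have "X (i + e + e * (int n - 1)) = X (i + int n)"
      using sign_cases[OF e] by (auto simp: X_eq_iff)
    then show ?thesis
      using shortens_tail_not_big[OF e True chain.prems] big_iff[OF e, of "i + e"] by simp
  next
    case False
    then show ?thesis
      using length_act[of i v] length_act[of "i + int n" "act i v"] IH by (simp split: if_splits)
  qed
  then have "act (i + int n) (tail (- e) (i + int n) @ act i v) = tail e (i + int n + int n) @ v"
    using act_chain[of "- e" "i + int n" "act i v"] e IH by simp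
  also have "tail e (i + int n + int n) = tail e i"
    by (rule tail_cong) (simp add: X_eq_iff)
  finally show ?case using act_chain[OF chain(1,2)] by simp
qed

section \<open>The action of words and the relation between the two sides\<close>

lemma act_cong:
  assumes "X i = X j"
  shows "act i w = act j w"
proof (induction w rule: act_induct[of _ i])
  case (cancel v)
  have "X (i + int n) = X (j + int n)" using assms by (simp add: X_eq_iff)
  then show ?case using act_cancel act_cancel' by metis
next
  case (chain e v)
  have *: "big e (X j) \<or> shortens j v" using chain(2) assms shortens_cong by metis
  have "X (i + int n) = X (j + int n)" using assms by (simp add: X_eq_iff)
  then show ?case
    using act_chain[OF chain(1,2)] act_chain[OF chain(1) *] chain(3) tail_cong assms by metis
next
  case (ok w)
  then show ?case using ok_cong[OF assms] assms by (simp add: act_ok)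
qed

lemma act_inverse': "irred w \<Longrightarrow> act i (act (i + int n) w) = w"
  using act_inverse[of w "i + int n"] act_cong[of "i + int n + int n" i] by (simp add: X_eq_iff)

text \<open>By \<open>act_cong\<close> the action depends on the index only modulo
  \<open>2 * n\<close>, so any index of the letter serves.\<close>

definition letter_act :: "'a \<Rightarrow> 'a list \<Rightarrow> 'a list" where
  "letter_act a = act (SOME i. X i = a)"

lemma letter_act_X [simp]: "letter_act (X i) = act i"
  unfolding letter_act_def by (rule ext, rule act_cong, rule someI) simp

abbreviation word_act :: "'a list \<Rightarrow> 'a list \<Rightarrow> 'a list" where
  "word_act \<equiv> foldr letter_act"

lemma irred_word_act: "set u \<subseteq> range X \<Longrightarrow> irred w \<Longrightarrow> irred (word_act u w)"
  by (induction u) (auto simp: irred_act)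

lemma word_act_irred: "irred (u @ w) \<Longrightarrow> word_act u w = u @ w"
proof (induction u)
  case (Cons a u)
  then obtain i where "a = X i" by (auto elim: irred.cases)
  then show ?case using Cons by (simp add: act_ok)
qed simp

lemma set_run: "set (run e i m) \<subseteq> range X"
  by (auto simp: run_def)

lemma run_top: "run e i n = X i # tail e i"
proof -
  have "n = Suc (n - 1)" using n_ge by simp
  then have "run e i n = run e i (Suc (n - 1))" by (rule arg_cong)
  then show ?thesis by (simp only: run_Suc tail_def)
qed

lemma run_bot:
  assumes "\<bar>e\<bar> = 1"
  shows "run (- e) (i + e * (int n - 1)) n = tail (- e) (i + int n) @ [X i]"
proof -
  let ?k = "i + e * (int n - 1)"
  have "X ?k = X (i + int n + - e)"
    using sign_cases[OF assms] by (auto simp: X_eq_iff)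
  then have "run (- e) ?k (n - 1) = tail (- e) (i + int n)"
    unfolding tail_def by (rule run_cong)
  moreover have "?k + - e * int (n - 1) = i"
    using n_ge by (simp add: of_nat_diff)
  moreover have "n = Suc (n - 1)" using n_ge by simp
  then have "run (- e) ?k n = run (- e) ?k (Suc (n - 1))" by (rule arg_cong)
  ultimately show ?thesis by (simp only: run_Suc_last)
qed

text \<open>
  Both sides trace a half of the boundary of a \<open>2n\<close>-gon that starts at \<open>w\<close>. If one of the
  neighbours of \<open>w\<close> on this boundary is shorter than \<open>w\<close>, the polygon is rotated to start there;
  otherwise the two halves can be computed without any cancellation.
\<close>

lemma word_act_run:
  assumes "\<bar>e\<bar> = 1" "irred w"
  shows "word_act (run e i n) w = word_act (run (- e) (i + e * (int n - 1)) n) w"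
  using assms
proof (induction w arbitrary: e i rule: length_induct)
  case (1 w)
  let ?goal = "\<lambda>e i. word_act (run e i n) w = word_act (run (- e) (i + e * (int n - 1)) n) w"
  have short: "?goal e i" if e: "\<bar>e\<bar> = 1" and sh: "shortens i w" for e i
  proof -
    let ?w = "act i w"
    have w: "w = act (i + int n) ?w" and irr: "irred ?w"
      using act_inverse irred_act 1(3) by auto
    have "length ?w < length w" using length_act[of i w] sh by simp
    then have IH: "word_act (run e (i + e) n) ?w
        = word_act (run (- e) (i + e + e * (int n - 1)) n) ?w"
      using 1(1) e irr by blast
    have "run e (i + e) n = tail e i @ [X (i + int n)]"
      using run_top[of e "i + e"] tail_rotate[OF e, of i "[]"] by simp
    then have l: "word_act (run e (i + e) n) ?w = word_act (tail e i) w"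
      using w by simp
    have c: "X (i + e + e * (int n - 1)) = X (i + int n)"
      using sign_cases[OF e] by (auto simp: X_eq_iff)
    have "run (- e) (i + e + e * (int n - 1)) n = X (i + int n) # tail (- e) (i + int n)"
      using run_cong[OF c, of "- e" n] run_top[of "- e" "i + int n"] by simp
    then have r: "word_act (tail e i) w = act (i + int n) (word_act (tail (- e) (i + int n)) ?w)"
      using IH l by simp
    have "irred (word_act (tail (- e) (i + int n)) ?w)"
      by (rule irred_word_act) (use set_run irr in \<open>auto simp: tail_def\<close>)
    then have "act i (word_act (tail e i) w) = word_act (tail (- e) (i + int n)) ?w"
      unfolding r by (rule act_inverse')
    then show ?thesis unfolding run_top[of e i] run_bot[OF e, of i] by simp
  qed
  have long: "?goal e i"
    if e: "\<bar>e\<bar> = 1" and b: "big e (X i)" and ns: "\<not> shortens i w"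
      "\<not> shortens (i + e * (int n - 1)) w" for e i
  proof -
    let ?k = "i + e * (int n - 1)"
    have k: "X (?k + e) = X (i + int n)" using sign_cases[OF e] by (auto simp: X_eq_iff)
    have no: "w \<noteq> X (?k + e) # v" for v
      using ns(1) shortens.cancel[of i v] k by auto
    \<comment> \<open>In direction \<open>e\<close> the tail of \<open>?k\<close> begins with the
      inverse of \<open>X i\<close>, which would shorten \<open>w\<close>; in direction
      \<open>- e\<close> the side at \<open>?k\<close> is the smaller one.\<close>
    have "w \<noteq> tail f ?k @ v" if "\<bar>f\<bar> = 1" "big f (X ?k)" for f v
    proof (cases "f = e")
      case True
      then show ?thesis using no by (simp add: tail_Cons)
    next
      case False
      then have "f = - e" using e that by linarith
      then show ?thesis using big_iff[OF e] b that by simp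
    qed
    then have "ok ?k w" using ns(2) by (auto simp: ok_def)
    then have "irred (run e (?k - e * int (n - 2)) (Suc (n - 2)) @ w)"
      by (intro irred_run_append) (use 1(3) e no n_ge in auto)
    moreover have "run e (?k - e * int (n - 2)) (Suc (n - 2)) = tail e i"
    proof -
      have "n - 1 = Suc (n - 2)" using n_ge by simp
      moreover have "?k - e * int (n - 2) = i + e"
        using n_ge by (simp add: of_nat_diff algebra_simps)
      ultimately show ?thesis unfolding tail_def by (simp only:)
    qed
    ultimately have irr: "irred (tail e i @ w)" by simp
    have "act i (tail e i @ w) = tail (- e) (i + int n) @ act i w"
      using act_chain e b by blast
    moreover from this have "word_act (tail (- e) (i + int n)) (act i w) = tail (- e) (i + int n) @ act i w"
      using irred_act[OF irr, of i] by (intro word_act_irred) simp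
    ultimately show ?thesis unfolding run_top[of e i] run_bot[OF e, of i] using word_act_irred[OF irr] by simp
  qed
  let ?k = "i + e * (int n - 1)"
  have sym: "?goal (- e) ?k \<Longrightarrow> ?goal e i" by simp
  have e: "\<bar>e\<bar> = 1" "\<bar>- e\<bar> = 1" using 1(2) by simp_all
  \<comment> \<open>Replacing \<open>(e, i)\<close> by \<open>(- e, ?k)\<close> exchanges the two
    halves, and by \<open>big_iff\<close> exactly one of them is leading.\<close>
  consider "shortens i w" | "shortens ?k w"
    | "\<not> shortens i w" "\<not> shortens ?k w" "big e (X i)"
    | "\<not> shortens i w" "\<not> shortens ?k w" "big (- e) (X ?k)"
    using big_iff[OF e(1), of i] by blast
  then show ?case
  proof cases
    case 1
    then show ?thesis using short e by blast
  next
    case 2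
    then show ?thesis using short e sym by blast
  next
    case 3
    then show ?thesis using long e by blast
  next
    case 4
    then have "?goal (- e) ?k" by (intro long) (use e in simp_all)
    then show ?thesis by (rule sym)
  qed
qed

end

section \<open>Irreducible words contain no leading word\<close>

abbreviation iter :: "'a list \<Rightarrow> nat \<Rightarrow> 'a list" where
  "iter w s \<equiv> concat (replicate s w)"

lemma set_iter: "set (iter w s) \<subseteq> set w"
  by auto

lemma iter_snoc: "iter w (Suc s) = iter w s @ w"
  by (induction s) simp_all

context cyclic_relator
begin

text \<open>Leading word and remaining word of each element of \<open>D\<close>, in the circular
  notation. Chains occur only for letters that begin the smaller side in both directions; for any
  other letter a chain word contains the leading word of a turn, at its front or at its end.\<close>

definition rules :: "('a list \<times> 'a list) set" where
  "rules = {([X i, X (i + int n)], []) | i. True}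
     \<union> {(X i # tail e i, tail (- e) (i + int n) @ [X i]) | e i. \<bar>e\<bar> = 1 \<and> big e (X i)}
     \<union> {(X i # iter (tail e i) s @ [X (i + int n)], iter (tail (- e) (i + int n)) s) | e i s.
          \<bar>e\<bar> = 1 \<and> s \<ge> 1 \<and> \<not> big 1 (X i) \<and> \<not> big (-1) (X i)}"

lemma rules_cancel: "([X i, X (i + int n)], []) \<in> rules"
  unfolding rules_def by blast

lemma rules_turn:
  "\<bar>e\<bar> = 1 \<Longrightarrow> big e (X i) \<Longrightarrow> (X i # tail e i, tail (- e) (i + int n) @ [X i]) \<in> rules"
  unfolding rules_def by blast

lemma rules_chain:
  "\<bar>e\<bar> = 1 \<Longrightarrow> s \<ge> 1 \<Longrightarrow> \<not> big 1 (X i) \<Longrightarrow> \<not> big (-1) (X i)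
    \<Longrightarrow> (X i # iter (tail e i) s @ [X (i + int n)], iter (tail (- e) (i + int n)) s) \<in> rules"
  unfolding rules_def by blast

lemma rules_cases [consumes 1, case_names cancel turn chain]:
  assumes "(u, v) \<in> rules"
  obtains i where "u = [X i, X (i + int n)]" "v = []"
  | e i where "\<bar>e\<bar> = 1" "big e (X i)" "u = X i # tail e i" "v = tail (- e) (i + int n) @ [X i]"
  | e i s where "\<bar>e\<bar> = 1" "s \<ge> 1" "\<not> big 1 (X i)" "\<not> big (-1) (X i)"
      "u = X i # iter (tail e i) s @ [X (i + int n)]" "v = iter (tail (- e) (i + int n)) s"
  using assms unfolding rules_def by blast

lemma set_tail: "set (tail e i) \<subseteq> range X"
  unfolding tail_def by (rule set_run)

lemma rules_range: "(u, v) \<in> rules \<Longrightarrow> set u \<subseteq> range X \<and> set v \<subseteq> range X"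
proof (induction rule: rules_cases)
  case (chain e i s)
  then show ?case using set_tail set_iter by fastforce
qed (use set_tail in auto)

text \<open>By \<open>irred_tail_no_inverse\<close> the direction cannot change along the chain,
  which makes it a power of a single tail.\<close>

lemma shortens_iter:
  assumes "shortens i w" "irred w"
  shows "\<exists>e s v. \<bar>e\<bar> = 1 \<and> w = iter (tail e i) s @ X (i + int n) # v"
  using assms
proof induction
  case (cancel w)
  show ?case by (intro exI[of _ 1] exI[of _ 0] exI[of _ w]) simp
next
  case (chain e w)
  then obtain f s v where f: "\<bar>f\<bar> = 1" "w = iter (tail f i) s @ X (i + int n) # v"
    using irred_appendD by blast
  have "iter (tail f i) s = iter (tail e i) s"
  proof (cases s)
    case (Suc t)
    have "f = e"
    proof (rule ccontr)
      assume "f \<noteq> e"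
      then have "f = - e" using f chain.hyps by linarith
      then have "w = X (i - e) # run (- e) (i - 2 * e) (n - 2) @ iter (tail f i) t @ X (i + int n) # v"
        using f(2) by (simp add: Suc tail_Cons)
      then show False using irred_tail_no_inverse[OF chain.hyps(1) chain.prems] by blast
    qed
    then show ?thesis by simp
  qed simp
  then have "tail e i @ w = iter (tail e i) (Suc s) @ X (i + int n) # v"
    using f(2) by simp
  then show ?case using chain.hyps(1) by blast
qed

text \<open>For a chain in direction \<open>e\<close> at \<open>X i\<close> there are three
  possibilities. If the side in direction \<open>e\<close> is leading, the first tail completes a
  leading word. If only the opposite side is leading, one is found at the end of the chain, and this
  is what the assumption \<open>turn\<close> is for. If neither is leading, the whole chain up to
  the inverse is a leading word.\<close>

lemma redex:
  assumes turn: "\<And>e i. \<bar>e\<bar> = 1 \<Longrightarrow> big (- e) (X i) \<Longrightarrow> \<not> big e (X i) \<Longrightarrow> big e (X (i + e))"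
    and "set w \<subseteq> range X" "\<not> irred w"
  shows "\<exists>\<gamma> u v \<delta>. (u, v) \<in> rules \<and> w = \<gamma> @ u @ \<delta>"
  using assms(2,3)
proof (induction w)
  case Nil
  then show ?case using irred.Nil by blast
next
  case (Cons a w)
  then obtain i where a: "a = X i" by auto
  show ?case
  proof (cases "irred w")
    case False
    then obtain \<gamma> u v \<delta> where "(u, v) \<in> rules" "w = \<gamma> @ u @ \<delta>" using Cons by auto
    then show ?thesis by (metis append_Cons)
  next
    case True
    then have "\<not> ok i w" using Cons.prems a by simp
    then have "shortens i w \<or> (\<exists>e v. \<bar>e\<bar> = 1 \<and> big e (X i) \<and> w = tail e i @ v)"
      by (auto simp: ok_def)
    then have "(\<exists>e v. \<bar>e\<bar> = 1 \<and> big e (X i) \<and> w = tail e i @ v)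
      \<or> (\<exists>e s v. \<bar>e\<bar> = 1 \<and> w = iter (tail e i) s @ X (i + int n) # v)"
      using shortens_iter True by blast
    then show ?thesis
    proof (elim disjE exE conjE)
      fix e v
      assume e: "\<bar>e\<bar> = 1" "big e (X i)" and w: "w = tail e i @ v"
      have "(X i # tail e i, tail (- e) (i + int n) @ [X i]) \<in> rules"
        using e by (rule rules_turn)
      moreover have "a # w = [] @ (X i # tail e i) @ v" by (simp add: a w)
      ultimately show ?thesis by blast
    next
      fix e s v
      assume e: "\<bar>e\<bar> = 1" and w: "w = iter (tail e i) s @ X (i + int n) # v"
      consider "s = 0" | "s \<ge> 1" "big e (X i)" | "s \<ge> 1" "\<not> big e (X i)" "big (- e) (X i)"
        | "s \<ge> 1" "\<not> big 1 (X i)" "\<not> big (-1) (X i)"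
        using sign_cases[OF e] by force
      then show ?thesis
      proof cases
        case 1
        note rules_cancel[of i]
        moreover have "a # w = [] @ [X i, X (i + int n)] @ v" by (simp add: a w 1)
        ultimately show ?thesis by blast
      next
        case 2
        then obtain t where s: "s = Suc t" by (cases s) auto
        have "(X i # tail e i, tail (- e) (i + int n) @ [X i]) \<in> rules"
          using e 2(2) by (rule rules_turn)
        moreover have "a # w = [] @ (X i # tail e i) @ iter (tail e i) t @ X (i + int n) # v"
          by (simp add: a w s)
        ultimately show ?thesis by blast
      next
        case 3
        then obtain t where s: "s = Suc t" by (cases s) auto
        have pow: "iter (tail e i) s = iter (tail e i) t @ tail e i"
          unfolding s by (rule iter_snoc)
        \<comment> \<open>The last tail together with the inverse letter is the complete side
          starting at \<open>X (i + e)\<close>.\<close>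
        have "tail e i @ [X (i + int n)] = X (i + e) # tail e (i + e)"
          using tail_rotate[OF e, of i "[]"] by simp
        then have "a # w = (X i # iter (tail e i) t) @ (X (i + e) # tail e (i + e)) @ v"
          using a w pow by (metis append.assoc append_Cons append_Nil)
        moreover have "(X (i + e) # tail e (i + e), tail (- e) (i + e + int n) @ [X (i + e)]) \<in> rules"
          using e turn[OF e 3(3,2)] by (rule rules_turn)
        ultimately show ?thesis by blast
      next
        case 4
        have "(X i # iter (tail e i) s @ [X (i + int n)], iter (tail (- e) (i + int n)) s) \<in> rules"
          using e 4 by (rule rules_chain)
        moreover have "a # w = [] @ (X i # iter (tail e i) s @ [X (i + int n)]) @ v"
          by (simp add: a w)
        ultimately show ?thesis by blast
      qed
    qed
  qed
qed

section \<open>The rules as consequences of the presentation\<close>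

sublocale word_action "range X" "{w. irred w}" letter_act
proof
  fix a
  assume "a \<in> range X"
  then obtain i where "a = X i" by blast
  then show "bij_betw (letter_act a) {w. irred w} {w. irred w}"
    by (intro bij_betw_byWitness[of _ "act (i + int n)"]) (auto simp: act_inverse act_inverse' irred_act)
qed

text \<open>Stated for an arbitrary ideal because it is applied both to the ideal of the group and
  to the annihilator of the action: in either case the inverse relations and a single instance of
  the relator give all rules.\<close>

lemma rules_word_cong:
  fixes I :: "('a, 'k::field) nc_poly set"
  assumes "ideal I (free_algebra (range X))"
    and inv: "\<And>i. word_poly [X i, X (i + int n)] - 1 \<in> I"
    and rel: "word_poly (run 1 k n) - word_poly (run (-1) (k + (int n - 1)) n) \<in> I"
    and uv: "(u, v) \<in> rules"
  shows "word_poly u - word_poly v \<in> I"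
proof -
  interpret I: free_algebra_ideal "range X" I
    using assms(1) by (rule free_algebra_ideal.intro)
  have lists: "run e i m \<in> lists (range X)" "tail e i \<in> lists (range X)"
    "iter (tail e i) s \<in> lists (range X)" for e i m s
    using set_run[of e i m] set_tail[of e i] set_iter[of s "tail e i"] by auto
  have inv': "I.word_cong (p @ X i # X (i + int n) # q) (p @ q)"
    if "p \<in> lists (range X)" "q \<in> lists (range X)" for p q i
    using I.word_cong_context[OF _ that, of "[X i, X (i + int n)]" "[]"] inv[of i]
    by (simp add: I.word_cong_def word_poly_Nil)
  have XX: "X (i + int n + int n) = X i" for i by (simp add: X_eq_iff)
  let ?P = "\<lambda>i. I.word_cong (run 1 i n) (run (-1) (i + (int n - 1)) n)"
  \<comment> \<open>Conjugation by \<open>X i\<close> rotates the relation by one position.\<close>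
  have step: "?P (i + 1)" if "?P i" for i
  proof -
    have "X i # run 1 (i + 1) n = run 1 i n @ [X (i + int n)]"
      using run_Suc[of 1 i n] run_Suc_last[of 1 i n] by simp
    then have "I.word_cong (run 1 (i + 1) n) (X (i + int n) # run 1 i n @ [X (i + int n)])"
      using inv'[of "[]" "run 1 (i + 1) n" "i + int n"] lists I.word_cong_sym XX by simp
    also have "I.word_cong (X (i + int n) # run 1 i n @ [X (i + int n)])
        (X (i + int n) # run (-1) (i + (int n - 1)) n @ [X (i + int n)])"
      using I.word_cong_context[OF that, of "[X (i + int n)]" "[X (i + int n)]"] by simp
    also have "X (i + int n) # run (-1) (i + (int n - 1)) n = run (-1) (i + int n) n @ [X i]"
      using run_Suc[of "-1" "i + int n" n] run_Suc_last[of "-1" "i + int n" n]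
      by (simp add: algebra_simps)
    then have "X (i + int n) # run (-1) (i + (int n - 1)) n @ [X (i + int n)]
        = run (-1) (i + int n) n @ [X i, X (i + int n)]"
      by (metis append.assoc append_Cons append_Nil)
    also have "I.word_cong \<dots> (run (-1) (i + int n) n)"
      using inv'[of "run (-1) (i + int n) n" "[]" i] lists by simp
    finally show ?thesis by (simp add: algebra_simps)
  qed
  have P: "?P i" for i
  proof -
    have *: "?P (k + int m)" for m
    proof (induction m)
      case 0
      then show ?case using rel by (simp add: I.word_cong_def)
    next
      case (Suc m)
      then show ?case using step[of "k + int m"] by (simp add: algebra_simps)
    qed
    \<comment> \<open>\<open>step\<close> only increases the index, so \<open>i\<close> is reached
      from \<open>k\<close> modulo \<open>2 * n\<close>, after a nonnegative number of
      steps.\<close>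
    let ?m = "nat ((i - k) mod (2 * int n))"
    have "2 * int n dvd i - (k + int ?m)"
      using n_ge by (simp add: mod_eq_dvd_iff[symmetric] algebra_simps mod_simps minus_mod_eq_mult_div)
    then have "X i = X (k + int ?m)" "X (i + (int n - 1)) = X (k + int ?m + (int n - 1))"
      by (simp_all add: X_eq_iff algebra_simps)
    then have "run 1 i n = run 1 (k + int ?m) n"
      "run (-1) (i + (int n - 1)) n = run (-1) (k + int ?m + (int n - 1)) n"
      using run_cong by blast+
    then show ?thesis using *[of ?m] by (simp only:)
  qed
  have turn: "I.word_cong (X i # tail e i) (tail (- e) (i + int n) @ [X i])" if e: "\<bar>e\<bar> = 1" for e i
    using sign_cases[OF e]
  proof
    assume "e = 1"
    then show ?thesis using P[of i] run_top[of 1 i] run_bot[OF e, of i] by simp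
  next
    assume e: "e = - 1"
    have "I.word_cong (run (-1) i n) (run 1 (i - (int n - 1)) n)"
      using P[of "i - (int n - 1)"] I.word_cong_sym by simp
    moreover have "run 1 (i - (int n - 1)) n = tail 1 (i + int n) @ [X i]"
      using run_bot[of "-1" i] by (simp add: algebra_simps)
    ultimately show ?thesis using run_top[of "-1" i] e by simp
  qed
  \<comment> \<open>\<open>X i\<close> passes the tails one at a time; a chain rule follows by
    cancelling it against its inverse afterwards.\<close>
  have pow: "I.word_cong (X i # iter (tail e i) s @ q) (iter (tail (- e) (i + int n)) s @ X i # q)"
    if e: "\<bar>e\<bar> = 1" and q: "q \<in> lists (range X)" for e i s q
  proof (induction s)
    case (Suc s)
    have "I.word_cong (X i # iter (tail e i) (Suc s) @ q)
        (tail (- e) (i + int n) @ X i # iter (tail e i) s @ q)"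
      using I.word_cong_context[OF turn[OF e], of "[]" "iter (tail e i) s @ q"] lists q
      by simp
    also have "I.word_cong \<dots> (tail (- e) (i + int n) @ iter (tail (- e) (i + int n)) s @ X i # q)"
      using I.word_cong_context[OF Suc, of "tail (- e) (i + int n)" "[]"] lists by simp
    finally show ?case by simp
  qed simp
  have "I.word_cong u v"
    using uv
  proof (cases rule: rules_cases)
    case (cancel i)
    then show ?thesis using inv'[of "[]" "[]" i] by simp
  next
    case (turn e i)
    then show ?thesis using \<open>\<And>e i. \<bar>e\<bar> = 1 \<Longrightarrow> I.word_cong (X i # tail e i) _\<close> by simp
  next
    case (chain e i s)
    have "I.word_cong u (v @ [X i, X (i + int n)])"
      using pow[OF chain(1), of "[X (i + int n)]" i s] chain by simp
    also have "I.word_cong \<dots> v" using inv'[of v "[]" i] lists chain by simp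
    finally show ?thesis .
  qed
  then show ?thesis by (simp add: I.word_cong_def)
qed

end

section \<open>The surface group\<close>

definition cyc :: "nat \<Rightarrow> int \<Rightarrow> letter" where
  "cyc n k = (let m = nat ((k - 1) mod (2 * int n)) in if m < n then C (m + 1) else Cinv (m - n + 1))"

text \<open>The outcome of comparing the first letters of the two sides, \<open>X i\<close> and
  \<open>X (i + n - e)\<close>. Inverse letters win in both directions except $c_1^{-1}$, which
  loses to $c_n^{-1}$ for \<open>e = 1\<close>; plain letters lose except $c_1$, which wins against
  $c_n$ for \<open>e = 1\<close>.\<close>

fun big_turn :: "int \<Rightarrow> letter \<Rightarrow> bool" where
  "big_turn e (C j) \<longleftrightarrow> e = 1 \<and> j = 1"
| "big_turn e (Cinv j) \<longleftrightarrow> (e = 1 \<longrightarrow> j \<noteq> 1)"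

lemma cyc_C: "1 \<le> j \<Longrightarrow> j \<le> n \<Longrightarrow> cyc n (int j) = C j"
proof -
  assume "1 \<le> j" "j \<le> n"
  then have *: "(int j - 1) mod (2 * int n) = int (j - 1)"
    by (simp add: of_nat_diff)
  show ?thesis unfolding cyc_def * nat_int Let_def using \<open>1 \<le> j\<close> \<open>j \<le> n\<close> by simp
qed

lemma cyc_Cinv: "1 \<le> j \<Longrightarrow> j \<le> n \<Longrightarrow> cyc n (int n + int j) = Cinv j"
proof -
  assume "1 \<le> j" "j \<le> n"
  then have *: "(int n + int j - 1) mod (2 * int n) = int (n + j - 1)"
    by (simp add: of_nat_diff)
  show ?thesis unfolding cyc_def * nat_int Let_def using \<open>1 \<le> j\<close> \<open>j \<le> n\<close> by simp
qed

lemma cyc_eq_iff: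
  assumes "n \<ge> 1"
  shows "cyc n a = cyc n b \<longleftrightarrow> 2 * int n dvd a - b"
proof -
  have "cyc n a = cyc n b \<longleftrightarrow> nat ((a - 1) mod (2 * int n)) = nat ((b - 1) mod (2 * int n))"
    by (auto simp: cyc_def Let_def split: if_splits)
  also have "\<dots> \<longleftrightarrow> (a - 1) mod (2 * int n) = (b - 1) mod (2 * int n)"
    using assms by (simp add: eq_nat_nat_iff)
  also have "\<dots> \<longleftrightarrow> 2 * int n dvd a - b"
    by (simp add: mod_eq_dvd_iff)
  finally show ?thesis .
qed

lemma cyc_cases [consumes 1, case_names C Cinv]:
  assumes "n \<ge> 1"
  obtains (C) j where "1 \<le> j" "j \<le> n" "cyc n i = cyc n (int j)"
  | (Cinv) j where "1 \<le> j" "j \<le> n" "cyc n i = cyc n (int n + int j)"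
proof -
  let ?m = "nat ((i - 1) mod (2 * int n))"
  have "?m < 2 * n" using assms by (simp add: nat_less_iff)
  show thesis
  proof (cases "?m < n")
    case True
    then have "cyc n i = C (?m + 1)" by (simp add: cyc_def)
    then show thesis using that(1)[of "?m + 1"] cyc_C[of "?m + 1" n] True by simp
  next
    case False
    then have "cyc n i = Cinv (?m - n + 1)" by (simp add: cyc_def)
    then show thesis
      using that(2)[of "?m - n + 1"] cyc_Cinv[of "?m - n + 1" n] \<open>?m < 2 * n\<close> by simp
  qed
qed

lemma cyc_shift: "n \<ge> 1 \<Longrightarrow> cyc n i = cyc n j \<Longrightarrow> cyc n (i + k) = cyc n (j + k)"
  by (simp add: cyc_eq_iff)

lemma cyc_period: "n \<ge> 1 \<Longrightarrow> cyc n (2 * int n + i) = cyc n i"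
  by (simp add: cyc_eq_iff)

lemma big_turn_iff:
  assumes n: "n \<ge> 1"
  shows "big_turn 1 (cyc n i) \<longleftrightarrow> \<not> big_turn (-1) (cyc n (i + (int n - 1)))"
  using n
proof (cases rule: cyc_cases[where i = i])
  case (C j)
  then have shift: "cyc n (i + (int n - 1)) = cyc n (int j + (int n - 1))" using n cyc_shift by blast
  show ?thesis
  proof (cases "j = 1")
    case True
    then show ?thesis using C n shift cyc_C[of n n] cyc_C[of j n] by simp
  next
    case False
    then have *: "int j + (int n - 1) = int n + int (j - 1)" using C by simp
    have "cyc n (i + (int n - 1)) = Cinv (j - 1)"
      unfolding shift * by (rule cyc_Cinv) (use C False in auto)
    then show ?thesis using C False cyc_C[of j n] by simp
  qed
next
  case (Cinv j)
  then have shift: "cyc n (i + (int n - 1)) = cyc n (int n + int j + (int n - 1))"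
    using n cyc_shift by blast
  show ?thesis
  proof (cases "j = 1")
    case True
    then show ?thesis using Cinv n shift cyc_Cinv[of n n] cyc_Cinv[of j n] by simp
  next
    case False
    then have *: "int n + int j + (int n - 1) = 2 * int n + int (j - 1)" using Cinv by simp
    have "cyc n (i + (int n - 1)) = C (j - 1)"
      unfolding shift * cyc_period[OF n] by (rule cyc_C) (use Cinv False in auto)
    then show ?thesis using Cinv False cyc_Cinv[of j n] by simp
  qed
qed

section \<open>The order on words\<close>

interpretation word_order: admissible_order word_order
proof
  show "trans word_order"
    unfolding word_order_def
  proof (intro lenlex_transI transI)
    fix a b c
    assume "(a, b) \<in> {(a, b). letter_less a b}" "(b, c) \<in> {(a, b). letter_less a b}"
    then show "(a, c) \<in> {(a, b). letter_less a b}"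
      by (cases a; cases b; cases c) auto
  qed
  have irrefl: "\<not> letter_less a a" for a by (cases a) auto
  then show "(w, w) \<notin> word_order" for w
    unfolding word_order_def by (intro lenlex_irreflexive) auto
  have "total {(a, b). letter_less a b}"
    unfolding total_on_def
  proof (intro ballI impI)
    fix a b :: letter
    assume "a \<noteq> b"
    then show "(a, b) \<in> {(a, b). letter_less a b} \<or> (b, a) \<in> {(a, b). letter_less a b}"
      by (cases a; cases b) auto
  qed
  then show "total word_order"
    unfolding word_order_def by (rule total_lenlex)
  show "(p @ u @ q, p @ v @ q) \<in> word_order" if "(u, v) \<in> word_order" for u v p q
    using that irrefl unfolding word_order_def by (simp add: irrefl_def lenlex_append1)
qed

lemma lenlex_map:
  assumes "(u, v) \<in> lenlex r" "set u \<subseteq> A" "set v \<subseteq> A"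
    and "\<And>a b. (a, b) \<in> r \<Longrightarrow> a \<in> A \<Longrightarrow> b \<in> A \<Longrightarrow> (f a, f b) \<in> r'"
  shows "(map f u, map f v) \<in> lenlex r'"
  using assms(1-3)
proof (induction u arbitrary: v)
  case (Cons a u)
  then show ?case using assms(4) by (cases v) (auto simp: Cons_lenlex_iff)
qed (cases v, auto)

text \<open>The restriction to the alphabet matters: on all letters \<open>C 1\<close>,
  \<open>C 2\<close>, \<open>C 3\<close> and so on is an infinite descending sequence.\<close>

lemma wf_word_order: "wf (word_order \<inter> lists (alphabet g) \<times> lists (alphabet g))"
proof (rule wf_subset)
  \<comment> \<open>Strictly monotone on the alphabet, where indices are at most
    \<open>2 * g\<close> and the subtraction is not truncated.\<close>
  define rank where "rank a = (case a of C i \<Rightarrow> 2 * g - i | Cinv i \<Rightarrow> 2 * g + i)" for a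
  show "wf (inv_image (lenlex less_than) (map rank))" by (intro wf_inv_image wf_lenlex wf_less_than)
  have less: "(rank a, rank b) \<in> less_than"
    if "(a, b) \<in> {(a, b). letter_less a b}" "a \<in> alphabet g" "b \<in> alphabet g" for a b
    using that by (cases a; cases b) (auto simp: rank_def alphabet_def)
  have "(map rank u, map rank v) \<in> lenlex less_than"
    if "(u, v) \<in> word_order" "u \<in> lists (alphabet g)" "v \<in> lists (alphabet g)" for u v
    using that less unfolding word_order_def by (intro lenlex_map[of u v _ "alphabet g"]) auto
  then show "word_order \<inter> lists (alphabet g) \<times> lists (alphabet g) \<subseteq> inv_image (lenlex less_than) (map rank)"
    by (intro subrelI) (simp only: in_inv_image Int_iff mem_Sigma_iff)
qed

section \<open>The action never enlarges words\<close>

locale oriented_surface =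
  fixes n :: nat
  assumes four_le: "4 \<le> n"
begin

lemma n_pos: "n \<ge> 1"
  using four_le by simp

sublocale cyclic_relator n "cyc n" big_turn
proof
  show "4 \<le> n" by (rule four_le)
  show "cyc n a = cyc n b \<longleftrightarrow> 2 * int n dvd a - b" for a b by (rule cyc_eq_iff[OF n_pos])
  show "big_turn e (cyc n i) \<longleftrightarrow> \<not> big_turn (- e) (cyc n (i + e * (int n - 1)))"
    if "\<bar>e\<bar> = 1" for e i
  proof -
    consider "e = 1" | "e = -1" using \<open>\<bar>e\<bar> = 1\<close> by linarith
    then show ?thesis
    proof cases
      case 1
      then show ?thesis using big_turn_iff[OF n_pos, of i] by simp
    next
      case 2
      then have k: "i + e * (int n - 1) = i - (int n - 1)" by simp
      show ?thesis unfolding k unfolding 2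
        using big_turn_iff[OF n_pos, of "i - (int n - 1)"] by simp
    qed
  qed
qed

text \<open>\<open>X (i + n - e)\<close> is the first letter of the turned word
  \<open>tail (- e) (i + n)\<close>. Both sides have the same length, so the first letters
  decide.\<close>

lemma big_less:
  assumes "\<bar>e\<bar> = 1" "big_turn e (cyc n i)"
  shows "letter_less (cyc n (i + int n - e)) (cyc n i)"
  using n_pos
proof (cases rule: cyc_cases[where i = i])
  case (C j)
  then have "e = 1" "j = 1" using assms(2) cyc_C by auto
  then have *: "i + int n - e = i + (int n - 1)" by simp
  have "cyc n (i + int n - e) = C n"
    unfolding * cyc_shift[OF n_pos C(3)] using \<open>j = 1\<close> cyc_C[of n n] n_pos by simp
  then show ?thesis using C \<open>j = 1\<close> cyc_C[of 1 n] four_le by simp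
next
  case (Cinv j)
  have shift: "cyc n (i + int n - e) = cyc n (2 * int n + (int j - e))"
    using cyc_shift[OF n_pos Cinv(3), of "int n - e"] by (simp add: algebra_simps)
  then have shift: "cyc n (i + int n - e) = cyc n (int j - e)" using cyc_period[OF n_pos] by simp
  show ?thesis
    using sign_cases[OF assms(1)]
  proof
    assume e: "e = 1"
    then have "j \<noteq> 1" using assms(2) Cinv cyc_Cinv by auto
    then have "int j - e = int (j - 1)" "1 \<le> j - 1" using Cinv e by auto
    then show ?thesis using shift Cinv cyc_C[of "j - 1" n] cyc_Cinv[of j n] by simp
  next
    assume e: "e = -1"
    show ?thesis
    proof (cases "j = n")
      case True
      then show ?thesis using shift Cinv e cyc_Cinv[of 1 n] cyc_Cinv[of j n] four_le by simp
    next
      case False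
      then have "int j - e = int (j + 1)" using e by simp
      then show ?thesis
        using shift Cinv False cyc_C[of "j + 1" n] cyc_Cinv[of j n] by (simp add: add.commute)
    qed
  qed
qed

lemma rules_decreasing: "(u, v) \<in> rules \<Longrightarrow> (v, u) \<in> word_order"
proof (induction rule: rules_cases)
  case (cancel i)
  then show ?case by (simp add: word_order_def)
next
  case (turn e i)
  then show ?case using big_less[of e i] n_ge
    by (simp add: word_order_def tail_Cons Cons_lenlex_iff algebra_simps)
next
  case (chain e i s)
  then show ?case by (simp add: word_order_def lenlex_conv length_concat sum_list_replicate)
qed

text \<open>If the action shortens, length alone decides. If it does not, a turn can only have been
  made because the side was leading, and then the first letter becomes smaller.\<close>

lemma act_le: "act i w = cyc n i # w \<or> (act i w, cyc n i # w) \<in> word_order"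
proof (induction w rule: act_induct[of _ i])
  case (cancel v)
  then show ?case by (simp add: word_order_def lenlex_conv)
next
  case (chain e v)
  show ?case
  proof (cases "shortens i (tail e i @ v)")
    case True
    then have "length (act i (tail e i @ v)) < length (cyc n i # tail e i @ v)"
      using length_act[of i "tail e i @ v"] by simp
    then show ?thesis by (simp add: word_order_def lenlex_conv)
  next
    case False
    then have "length (act i (tail e i @ v)) = length (cyc n i # tail e i @ v)"
      using length_act[of i "tail e i @ v"] by simp
    moreover have "big_turn e (cyc n i)" using False chain by auto
    ultimately show ?thesis
      using big_less[OF chain(1)] act_chain[OF chain(1,2)]
      by (simp add: word_order_def tail_Cons Cons_lenlex_iff algebra_simps)
  qed
next
  case (ok w)
  then show ?case by (simp add: act_ok)
qed

lemma word_act_le: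
  assumes "set w \<subseteq> range (cyc n)"
  shows "word_act w [] = w \<or> (word_act w [], w) \<in> word_order"
  using assms
proof (induction w)
  case (Cons a w)
  then obtain i where a: "a = cyc n i" by auto
  have "word_act w [] = w \<or> (cyc n i # word_act w [], cyc n i # w) \<in> word_order"
    using Cons word_order.append_r[of "word_act w []" w "[cyc n i]" "[]"] by auto
  then show ?case
    using act_le[of i "word_act w []"] transD[OF word_order.trans_r] a by auto
qed simp

text \<open>The only letters that are big in exactly one direction are $c_1$ and $c_1^{-1}$. Their
  neighbours in the other direction are $c_n^{-1}$ and $c_2^{-1}$, which are big there.\<close>

lemma turn: "\<bar>e\<bar> = 1 \<Longrightarrow> big_turn (- e) (cyc n i) \<Longrightarrow> \<not> big_turn e (cyc n i) \<Longrightarrow> big_turn e (cyc n (i + e))"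
  using n_pos
proof (cases rule: cyc_cases[where i = i])
  case (C j)
  assume e: "\<bar>e\<bar> = 1" "big_turn (- e) (cyc n i)" "\<not> big_turn e (cyc n i)"
  then have "e = -1" "j = 1" using C cyc_C by auto
  then show ?thesis
    using cyc_shift[OF n_pos C(3), of e] cyc_period[OF n_pos, of 0] cyc_Cinv[of n n] n_pos by simp
next
  case (Cinv j)
  assume e: "\<bar>e\<bar> = 1" "big_turn (- e) (cyc n i)" "\<not> big_turn e (cyc n i)"
  then have "e = 1" "j = 1" using Cinv cyc_Cinv by auto
  then show ?thesis
    using cyc_shift[OF n_pos Cinv(3), of e] cyc_Cinv[of 2 n] four_le by (simp add: add.commute)
qed

lemma leading_word_redex:
  fixes f :: "(letter, 'k::field) nc_poly"
  assumes f: "f \<in> annihilator" "f \<noteq> 0"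
  shows "\<exists>\<gamma> u v \<delta>. (u, v) \<in> rules \<and> leading_word word_order f = \<gamma> @ u @ \<delta>"
proof (rule ccontr)
  let ?w = "leading_word word_order f"
  assume no: "\<not> ?thesis"
  have keys: "Poly_Mapping.keys f \<subseteq> lists (range (cyc n))"
    using f by (simp add: annihilator_def carrier_free_algebra)
  have w: "?w \<in> Poly_Mapping.keys f" using word_order.leading_word(1)[OF f(2)] .
  then have "set ?w \<subseteq> range (cyc n)" using keys by auto
  then have irr: "irred ?w" using redex[OF turn] no by blast
  then have nf: "word_act ?w [] = ?w" using word_act_irred[of ?w "[]"] by simp
  have other: "word_act v [] \<noteq> ?w" if v: "v \<in> Poly_Mapping.keys f" "v \<noteq> ?w" for v
  proof
    assume *: "word_act v [] = ?w"
    have less: "(v, ?w) \<in> word_order" using word_order.leading_word(2)[OF f(2) v] .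
    have "set v \<subseteq> range (cyc n)" using v keys by auto
    then have "(?w, v) \<in> word_order" using word_act_le[of v] * v by auto
    then show False using less transD[OF word_order.trans_r] word_order.irrefl_r by blast
  qed
  have "coeff [] ?w f = (\<Sum>v\<in>Poly_Mapping.keys f. if v = ?w then Poly_Mapping.lookup f v else 0)"
    unfolding coeff_def using nf other by (intro sum.cong refl) auto
  also have "\<dots> = Poly_Mapping.lookup f ?w" using w by simp
  also have "\<dots> \<noteq> 0" using w by (simp add: in_keys_iff)
  finally have "coeff [] ?w f \<noteq> 0" .
  moreover have "coeff [] ?w f = 0" using f irr irred.Nil by (simp add: annihilator_def)
  ultimately show False by simp
qed

end

section \<open>Identification of the rules with D\<close>

lemma length_up [simp]: "length (up c a b) = Suc b - a"
  unfolding up_def by (simp del: upt_Suc)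

lemma length_down [simp]: "length (down c b a) = Suc b - a"
  unfolding down_def by (simp del: upt_Suc)

lemma nth_up: "k < Suc b - a \<Longrightarrow> up c a b ! k = c (a + k)"
  unfolding up_def by (simp del: upt_Suc)

lemma nth_down:
  assumes "k < Suc b - a"
  shows "down c b a ! k = c (b - k)"
proof -
  have "rev [a..<Suc b] ! k = [a..<Suc b] ! (Suc b - a - Suc k)"
    using assms by (subst rev_nth) (simp_all del: upt_Suc)
  also have "\<dots> = b - k" using assms by (subst nth_upt) auto
  finally show ?thesis using assms unfolding down_def by (simp del: upt_Suc)
qed

context oriented_surface
begin

lemma nth_run: "k < m \<Longrightarrow> run e i m ! k = cyc n (i + e * int k)"
  by (simp add: run_def)

lemma up_C: "1 \<le> a \<Longrightarrow> b \<le> n \<Longrightarrow> up C a b = run 1 (int a) (Suc b - a)"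
proof (rule nth_equalityI)
  fix k
  assume "1 \<le> a" "b \<le> n" "k < length (up C a b)"
  then show "up C a b ! k = run 1 (int a) (Suc b - a) ! k"
    using cyc_C[of "a + k" n] by (simp add: nth_up nth_run)
qed simp

lemma up_Cinv: "1 \<le> a \<Longrightarrow> b \<le> n \<Longrightarrow> up Cinv a b = run 1 (int n + int a) (Suc b - a)"
proof (rule nth_equalityI)
  fix k
  assume "1 \<le> a" "b \<le> n" "k < length (up Cinv a b)"
  then show "up Cinv a b ! k = run 1 (int n + int a) (Suc b - a) ! k"
    using cyc_Cinv[of "a + k" n] by (simp add: nth_up nth_run add.assoc)
qed simp

lemma down_C:
  assumes "1 \<le> a" "b \<le> n"
  shows "down C b a = run (-1) (int b) (Suc b - a)"
proof (rule nth_equalityI)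
  fix k
  assume "k < length (down C b a)"
  then have k: "k < Suc b - a" by simp
  then have "int b + - 1 * int k = int (b - k)" using assms by linarith
  then have "run (-1) (int b) (Suc b - a) ! k = cyc n (int (b - k))" unfolding nth_run[OF k] by (rule arg_cong)
  also have "\<dots> = C (b - k)" by (rule cyc_C) (use k assms in linarith)+
  finally show "down C b a ! k = run (-1) (int b) (Suc b - a) ! k" unfolding nth_down[OF k] ..
qed simp

lemma down_Cinv:
  assumes "1 \<le> a" "b \<le> n"
  shows "down Cinv b a = run (-1) (int n + int b) (Suc b - a)"
proof (rule nth_equalityI)
  fix k
  assume "k < length (down Cinv b a)"
  then have k: "k < Suc b - a" by simp
  then have "int n + int b + - 1 * int k = int n + int (b - k)" using assms by linarith
  then have "run (-1) (int n + int b) (Suc b - a) ! k = cyc n (int n + int (b - k))"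
    unfolding nth_run[OF k] by (rule arg_cong)
  also have "\<dots> = Cinv (b - k)" by (rule cyc_Cinv) (use k assms in linarith)+
  finally show "down Cinv b a ! k = run (-1) (int n + int b) (Suc b - a) ! k" unfolding nth_down[OF k] ..
qed simp

lemma tail_up_C:
  assumes "1 \<le> j" "j \<le> n"
  shows "tail 1 (int j) = up C (j + 1) n @ up Cinv 1 (j - 1)"
proof -
  have "n - 1 = (n - j) + (j - 1)" using assms by simp
  then have "tail 1 (int j) = run 1 (int j + 1) (n - j) @ run 1 (int j + 1 + 1 * int (n - j)) (j - 1)"
    unfolding tail_def by (simp only: run_add)
  also have "int j + 1 + 1 * int (n - j) = int n + int 1" using assms by simp
  finally show ?thesis using assms by (simp add: up_C up_Cinv add.commute)
qed

lemma tail_down_C: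
  assumes "1 \<le> j" "j \<le> n"
  shows "tail (-1) (int j) = down C (j - 1) 1 @ down Cinv n (j + 1)"
proof -
  have "n - 1 = (j - 1) + (n - j)" using assms by simp
  then have "tail (-1) (int j)
      = run (-1) (int j + - 1) (j - 1) @ run (-1) (int j + - 1 + - 1 * int (j - 1)) (n - j)"
    unfolding tail_def by (simp only: run_add)
  \<comment> \<open>Below position 1, the letter $c_1$, the circle continues at position 0, which is
    position \<open>2 * n\<close>, the letter $c_n^{-1}$.\<close>
  also have "run (-1) (int j + - 1 + - 1 * int (j - 1)) (n - j) = run (-1) (int n + int n) (n - j)"
    using assms by (intro run_cong) (simp add: X_eq_iff)
  also have "int j + - 1 = int (j - 1)" using assms by simp
  finally show ?thesis using assms by (simp add: down_C down_Cinv)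
qed

lemma tail_up_Cinv:
  assumes "1 \<le> j" "j \<le> n"
  shows "tail 1 (int n + int j) = up Cinv (j + 1) n @ up C 1 (j - 1)"
proof -
  have "n - 1 = (n - j) + (j - 1)" using assms by simp
  then have "tail 1 (int n + int j)
      = run 1 (int n + int j + 1) (n - j) @ run 1 (int n + int j + 1 + 1 * int (n - j)) (j - 1)"
    unfolding tail_def by (simp only: run_add)
  also have "run 1 (int n + int j + 1 + 1 * int (n - j)) (j - 1) = run 1 (int 1) (j - 1)"
    using assms by (intro run_cong) (simp add: X_eq_iff)
  also have "int n + int j + 1 = int n + int (j + 1)" by simp
  finally show ?thesis using assms by (simp only: up_C up_Cinv) simp
qed

lemma tail_down_Cinv:
  assumes "1 \<le> j" "j \<le> n"
  shows "tail (-1) (int n + int j) = down Cinv (j - 1) 1 @ down C n (j + 1)"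
proof -
  have "n - 1 = (j - 1) + (n - j)" using assms by simp
  then have "tail (-1) (int n + int j)
      = run (-1) (int n + int j + - 1) (j - 1) @ run (-1) (int n + int j + - 1 + - 1 * int (j - 1)) (n - j)"
    unfolding tail_def by (simp only: run_add)
  also have "int n + int j + - 1 + - 1 * int (j - 1) = int n" using assms by simp
  also have "int n + int j + - 1 = int n + int (j - 1)" using assms by simp
  finally show ?thesis using assms by (simp add: down_C down_Cinv)
qed

definition cancel_poly :: "int \<Rightarrow> (letter, 'k::field) nc_poly" where
  "cancel_poly i = word_poly [cyc n i, cyc n (i + int n)] - word_poly []"

definition turn_poly :: "int \<Rightarrow> int \<Rightarrow> (letter, 'k::field) nc_poly" where
  "turn_poly e i = word_poly (cyc n i # tail e i) - word_poly (tail (- e) (i + int n) @ [cyc n i])"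

definition chain_poly :: "int \<Rightarrow> int \<Rightarrow> nat \<Rightarrow> (letter, 'k::field) nc_poly" where
  "chain_poly e i s = word_poly (cyc n i # iter (tail e i) s @ [cyc n (i + int n)])
     - word_poly (iter (tail (- e) (i + int n)) s)"

lemma poly_cong:
  assumes "cyc n i = cyc n k"
  shows "cancel_poly i = (cancel_poly k :: (letter, 'k::field) nc_poly)"
    "turn_poly e i = (turn_poly e k :: (letter, 'k) nc_poly)"
    "chain_poly e i s = (chain_poly e k s :: (letter, 'k) nc_poly)"
proof -
  note [simp] = assms tail_cong[OF assms] cyc_shift[OF n_pos assms]
    tail_cong[OF cyc_shift[OF n_pos assms]]
  show "cancel_poly i = (cancel_poly k :: (letter, 'k) nc_poly)" by (simp add: cancel_poly_def)
  show "turn_poly e i = (turn_poly e k :: (letter, 'k) nc_poly)" by (simp add: turn_poly_def)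
  show "chain_poly e i s = (chain_poly e k s :: (letter, 'k) nc_poly)" by (simp add: chain_poly_def)
qed

lemma rules_poly_cases [consumes 1, case_names cancel turn chain]:
  assumes "(u, v) \<in> rules"
  obtains i where "word_poly u - word_poly v = (cancel_poly i :: (letter, 'k::field) nc_poly)"
  | e i where "\<bar>e\<bar> = 1" "big_turn e (cyc n i)"
      "word_poly u - word_poly v = (turn_poly e i :: (letter, 'k) nc_poly)"
  | e i s where "\<bar>e\<bar> = 1" "s \<ge> 1" "\<not> big_turn 1 (cyc n i)" "\<not> big_turn (-1) (cyc n i)"
      "word_poly u - word_poly v = (chain_poly e i s :: (letter, 'k) nc_poly)"
  using assms
proof (cases rule: rules_cases)
  case (cancel i)
  then show thesis using that(1)[of i] by (simp add: cancel_poly_def)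
next
  case (turn e i)
  then show thesis using that(2)[of e i] by (simp add: turn_poly_def)
next
  case (chain e i s)
  then show thesis using that(3)[of e s i] by (simp add: chain_poly_def)
qed

context
  fixes j :: nat
  assumes j: "1 \<le> j" "j \<le> n"
begin

lemmas letters = cyc_C[OF j] cyc_Cinv[OF j]

lemma cyc_shifts: "cyc n (int j + int n) = Cinv j" "cyc n (2 * int n + int j) = C j"
proof -
  show "cyc n (int j + int n) = Cinv j" using letters(2) by (simp only: add.commute)
  show "cyc n (2 * int n + int j) = C j" unfolding cyc_period[OF n_pos] by (rule letters)
qed

lemma tail_shifts: "tail e (int j + int n) = tail e (int n + int j)"
  "tail e (2 * int n + int j) = tail e (int j)"
  by (rule tail_cong, simp add: X_eq_iff)+

lemma up_Cons: "up c j n = c j # up c (j + 1) n"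
  using j by (simp add: up_def upt_conv_Cons del: upt_Suc)

lemma up_snoc: "up c 1 j = up c 1 (j - 1) @ [c j]"
  using j by (cases j) (simp_all add: up_def)

lemma down_Cons: "down c j 1 = c j # down c (j - 1) 1"
  using j by (cases j) (simp_all add: down_def)

lemma down_snoc: "down c n j = down c n (j + 1) @ [c j]"
  using j by (simp add: down_def upt_conv_Cons del: upt_Suc)

lemma cancel_poly_C: "cancel_poly (int j) = (D8 j :: (letter, 'k::field) nc_poly)"
  by (simp add: cancel_poly_def D8_def letters cyc_shifts word_poly_Nil)

lemma cancel_poly_Cinv: "cancel_poly (int n + int j) = (D7 j :: (letter, 'k::field) nc_poly)"
  by (simp add: cancel_poly_def D7_def letters cyc_shifts word_poly_Nil)

lemma turn_poly_D5:
  "(turn_poly 1 (int n + int j) :: (letter, 'k::field) nc_poly)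
     = word_poly (up Cinv j n @ up C 1 (j - 1)) - word_poly (down C (j - 1) 1 @ down Cinv n j)"
  by (simp add: turn_poly_def tail_shifts letters tail_up_Cinv[OF j] tail_down_C[OF j] up_Cons down_snoc)

text \<open>For \<open>j < n\<close> this is \<open>D6 g (j + 1)\<close>. For \<open>j = n\<close>
  the runs of plain letters are empty and it is \<open>D3 g\<close>.\<close>

lemma turn_poly_D6:
  "(turn_poly (-1) (int n + int j) :: (letter, 'k::field) nc_poly)
     = word_poly (down Cinv j 1 @ down C n (j + 1)) - word_poly (up C (j + 1) n @ up Cinv 1 j)"
  unfolding down_Cons up_snoc[of Cinv]
  by (simp add: turn_poly_def tail_shifts letters tail_down_Cinv[OF j] tail_up_C[OF j])

text \<open>At \<open>j = 1\<close> the runs of inverse letters are empty and this is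
  \<open>D4 g\<close>.\<close>

lemma turn_poly_D4:
  "(turn_poly 1 (int j) :: (letter, 'k::field) nc_poly)
     = word_poly (up C j n @ up Cinv 1 (j - 1)) - word_poly (down Cinv (j - 1) 1 @ down C n j)"
  by (simp add: turn_poly_def letters tail_up_C[OF j] tail_down_Cinv[OF j] up_Cons down_snoc
      tail_shifts)

lemma chain_poly_D2:
  "2 * g = n \<Longrightarrow> chain_poly 1 (int j) s = (D2 g j s :: (letter, 'k::field) nc_poly)"
  by (simp add: chain_poly_def D2_def letters tail_up_C[OF j] tail_down_Cinv[OF j] word_pow_def
      cyc_shifts tail_shifts)

lemma chain_poly_D1:
  "2 * g = n \<Longrightarrow> chain_poly (-1) (int j) s = (D1 g j s :: (letter, 'k::field) nc_poly)"
  by (simp add: chain_poly_def D1_def letters tail_down_C[OF j] tail_up_Cinv[OF j] word_pow_def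
      cyc_shifts tail_shifts)

end

lemma D_mem:
  "j \<in> {2..2 * g} \<Longrightarrow> s \<ge> 1 \<Longrightarrow> (D1 g j s :: (letter, 'k::field) nc_poly) \<in> D g"
  "j \<in> {2..2 * g} \<Longrightarrow> s \<ge> 1 \<Longrightarrow> (D2 g j s :: (letter, 'k) nc_poly) \<in> D g"
  "(D3 g :: (letter, 'k) nc_poly) \<in> D g"
  "(D4 g :: (letter, 'k) nc_poly) \<in> D g"
  "i \<in> {2..2 * g} \<Longrightarrow> (D5 g i :: (letter, 'k) nc_poly) \<in> D g"
  "i \<in> {2..2 * g} \<Longrightarrow> (D6 g i :: (letter, 'k) nc_poly) \<in> D g"
  "i \<in> {1..2 * g} \<Longrightarrow> (D7 i :: (letter, 'k) nc_poly) \<in> D g"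
  "i \<in> {1..2 * g} \<Longrightarrow> (D8 i :: (letter, 'k) nc_poly) \<in> D g"
  unfolding D_def by blast+

text \<open>The correspondence is by letter and direction. Turns: \<open>C 1\<close> gives
  \<open>D4\<close>; \<open>Cinv j\<close> gives \<open>D5\<close> upwards for
  \<open>j \<ge> 2\<close>, and downwards \<open>D6\<close>, or \<open>D3\<close> when
  \<open>j = n\<close>. Chains exist exactly for \<open>C j\<close> with \<open>j \<ge> 2\<close>
  and give \<open>D2\<close> upwards and \<open>D1\<close> downwards. Cancellations give
  \<open>D8\<close> and \<open>D7\<close>.\<close>

lemma rules_D:
  assumes g: "2 * g = n"
  shows "{word_poly u - word_poly v | u v. (u, v) \<in> rules} = (D g :: (letter, 'k::field) nc_poly set)"
proof (rule equalityI; rule subsetI)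
  fix p :: "(letter, 'k) nc_poly"
  assume "p \<in> {word_poly u - word_poly v | u v. (u, v) \<in> rules}"
  then obtain u v where "(u, v) \<in> rules" and uv: "p = word_poly u - word_poly v" by blast
  from this(1) show "p \<in> D g"
  proof (cases rule: rules_poly_cases[where 'k = 'k])
    case (cancel i)
    from n_pos show ?thesis
    proof (cases rule: cyc_cases[where i = i])
      case (C j)
      then have "p = D8 j"
        using uv cancel poly_cong(1)[OF C(3), where 'k = 'k] cancel_poly_C[OF C(1,2), where 'k = 'k] by simp
      then show ?thesis using C g D_mem(8)[of j g] by simp
    next
      case (Cinv j)
      then have "p = D7 j"
        using uv cancel poly_cong(1)[OF Cinv(3), where 'k = 'k] cancel_poly_Cinv[OF Cinv(1,2), where 'k = 'k] by simp
      then show ?thesis using Cinv g D_mem(7)[of j g] by simp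
    qed
  next
    case (turn e i)
    from n_pos show ?thesis
    proof (cases rule: cyc_cases[where i = i])
      case (C j)
      then have "e = 1" "j = 1" using turn cyc_C by auto
      then have "p = turn_poly 1 (int 1)"
        using uv turn(3) poly_cong(2)[OF C(3), where 'k = 'k] by simp
      then have "p = D4 g"
        using turn_poly_D4[of 1, where 'k = 'k] n_pos g by (simp add: D4_def up_def down_def)
      then show ?thesis using D_mem(4) by simp
    next
      case (Cinv j)
      then have p: "p = turn_poly e (int n + int j)"
        using uv turn(3) poly_cong(2)[OF Cinv(3), where 'k = 'k] by simp
      show ?thesis
        using sign_cases[OF turn(1)]
      proof
        assume "e = 1"
        then have "j \<noteq> 1" using turn Cinv cyc_Cinv by auto
        then have "p = D5 g j" "j \<in> {2..2 * g}"
          using p \<open>e = 1\<close> turn_poly_D5[of j, where 'k = 'k] Cinv g by (auto simp: D5_def)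
        then show ?thesis using D_mem(5) by simp
      next
        assume e: "e = -1"
        show ?thesis
        proof (cases "j = n")
          case True
          then have "p = D3 g"
            using p e turn_poly_D6[of j, where 'k = 'k] Cinv g by (simp add: D3_def up_def down_def)
          then show ?thesis using D_mem(3) by simp
        next
          case False
          then have "p = D6 g (j + 1)" "j + 1 \<in> {2..2 * g}"
            using p e turn_poly_D6[of j, where 'k = 'k] Cinv g by (auto simp: D6_def)
          then show ?thesis using D_mem(6)[of "j + 1" g] by simp
        qed
      qed
    qed
  next
    case (chain e i s)
    from n_pos show ?thesis
    proof (cases rule: cyc_cases[where i = i])
      case (C j)
      then have "j \<noteq> 1" using chain cyc_C by auto
      then have j: "j \<in> {2..2 * g}" using C g by auto
      have p: "p = chain_poly e (int j) s"
        using uv chain(5) poly_cong(3)[OF C(3), where 'k = 'k] by simp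
      show ?thesis
        using sign_cases[OF chain(1)]
      proof
        assume "e = 1"
        then have "p = D2 g j s" using p chain_poly_D2[OF C(1,2) g, where 'k = 'k] by simp
        then show ?thesis using j chain(2) D_mem(2) by simp
      next
        assume "e = -1"
        then have "p = D1 g j s" using p chain_poly_D1[OF C(1,2) g, where 'k = 'k] by simp
        then show ?thesis using j chain(2) D_mem(1) by simp
      qed
    next
      case (Cinv j)
      then show ?thesis using chain cyc_Cinv by auto
    qed
  qed
next
  let ?S = "{word_poly u - word_poly v | u v. (u, v) \<in> rules} :: (letter, 'k) nc_poly set"
  have binomial: "word_poly u - word_poly v \<in> ?S"
    if "(u, v) \<in> rules" for u v using that by blast
  have cancel: "cancel_poly i \<in> ?S" for i
    unfolding cancel_poly_def by (rule binomial) (rule rules_cancel)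
  have turn: "turn_poly e i \<in> ?S"
    if "\<bar>e\<bar> = 1" "big_turn e (cyc n i)" for e i
    unfolding turn_poly_def using that by (intro binomial rules_turn)
  have chain: "chain_poly e (int j) s \<in> ?S"
    if "\<bar>e\<bar> = 1" "j \<in> {2..n}" "s \<ge> 1" for e j s
    unfolding chain_poly_def using that cyc_C[of j n] by (intro binomial rules_chain) auto
  fix p :: "(letter, 'k) nc_poly"
  assume "p \<in> D g"
  then consider j s where "p = D1 g j s" "j \<in> {2..n}" "s \<ge> 1"
    | j s where "p = D2 g j s" "j \<in> {2..n}" "s \<ge> 1"
    | "p = D3 g" | "p = D4 g" | j where "p = D5 g j" "j \<in> {2..n}" | j where "p = D6 g j" "j \<in> {2..n}"
    | j where "p = D7 j" "j \<in> {1..n}" | j where "p = D8 j" "j \<in> {1..n}"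
    unfolding D_def g by blast
  then show "p \<in> ?S"
  proof cases
    case (1 j s)
    then show ?thesis using chain[of "-1" j s] chain_poly_D1[of j g s, where 'k = 'k] g by simp
  next
    case (2 j s)
    then show ?thesis using chain[of 1 j s] chain_poly_D2[of j g s, where 'k = 'k] g by simp
  next
    case 3
    then have "p = turn_poly (-1) (int n + int n)"
      using turn_poly_D6[of n, where 'k = 'k] n_pos g by (simp add: D3_def up_def down_def)
    then show ?thesis using turn[of "-1" "int n + int n"] cyc_Cinv[of n n] n_pos by simp
  next
    case 4
    then have "p = turn_poly 1 (int 1)"
      using turn_poly_D4[of 1, where 'k = 'k] n_pos g by (simp add: D4_def up_def down_def)
    then show ?thesis using turn[of 1 "int 1"] cyc_C[of 1 n] n_pos by simp
  next
    case (5 j)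
    then have "p = turn_poly 1 (int n + int j)"
      using turn_poly_D5[of j, where 'k = 'k] g by (simp add: D5_def)
    then show ?thesis using turn[of 1 "int n + int j"] cyc_Cinv[of j n] 5 by simp
  next
    case (6 j)
    then have j: "1 \<le> j - 1" "j - 1 \<le> n" by auto
    have "p = turn_poly (-1) (int n + int (j - 1))"
      using turn_poly_D6[OF j, where 'k = 'k] 6 g by (simp add: D6_def)
    then show ?thesis using turn[of "-1" "int n + int (j - 1)"] cyc_Cinv[OF j] by simp
  next
    case (7 j)
    then show ?thesis using cancel[of "int n + int j"] cancel_poly_Cinv[of j, where 'k = 'k] by simp
  next
    case (8 j)
    then show ?thesis using cancel[of "int j"] cancel_poly_C[of j, where 'k = 'k] by simp
  qed
qed

lemma range_cyc:
  assumes "2 * g = n"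
  shows "range (cyc n) = alphabet g"
proof (rule equalityI; rule subsetI)
  fix a
  assume "a \<in> range (cyc n)"
  then obtain i where a: "a = cyc n i" by blast
  from n_pos show "a \<in> alphabet g"
    by (cases rule: cyc_cases[where i = i]) (use a cyc_C cyc_Cinv assms in \<open>auto simp: alphabet_def\<close>)
next
  fix a
  assume "a \<in> alphabet g"
  then obtain j where j: "1 \<le> j" "j \<le> n" and "a = C j \<or> a = Cinv j"
    using assms by (auto simp: alphabet_def)
  then show "a \<in> range (cyc n)" using cyc_C[OF j] cyc_Cinv[OF j] by (metis rangeI)
qed

end

theorem theorem3p2:
  fixes g :: nat
  assumes "g \<ge> 2"
  shows "groebner_shirshov_basis (alphabet g) word_order
           (D g :: (letter, 'k::field) nc_poly set) (surface_group_ideal g)"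
proof -
  define n where "n = 2 * g"
  interpret oriented_surface n by unfold_locales (use assms n_def in simp)
  have g: "2 * g = n" by (simp add: n_def)
  note alphabet = range_cyc[OF g]
  let ?A = "free_algebra (alphabet g) :: (letter, 'k) nc_poly ring"
  let ?I = "surface_group_ideal g :: (letter, 'k) nc_poly set"
  let ?G = "{word_poly (up C 1 n) - word_poly (down C n 1)} \<union>
      {word_poly [C i, Cinv i] - 1 | i. i \<in> {1..n}} \<union>
      {word_poly [Cinv i, C i] - 1 | i. i \<in> {1..n}} :: (letter, 'k) nc_poly set"
  have I: "?I = genideal ?A ?G" unfolding surface_group_ideal_def g ..
  have rules: "(\<forall>x\<in>set u. x \<in> alphabet g) \<and> (\<forall>x\<in>set v. x \<in> alphabet g) \<and> (v, u) \<in> word_order"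
    if "(u, v) \<in> rules" for u v
    using rules_range[OF that] rules_decreasing[OF that] alphabet by blast
  interpret A: ring ?A by (rule ring_free_algebra)
  have G_D: "?G \<subseteq> D g"
    unfolding D_def g D4_def D7_def D8_def by blast
  have D_carrier: "D g \<subseteq> carrier ?A"
  proof
    fix p :: "(letter, 'k) nc_poly"
    assume "p \<in> D g"
    then obtain u v where "(u, v) \<in> rules" "p = word_poly u - word_poly v"
      using rules_D[OF g, where 'k = 'k] by blast
    then show "p \<in> carrier ?A" using rules[of u v] word_poly_diff_carrier[of u "alphabet g" v] by auto
  qed
  have ideal: "ideal ?I ?A" unfolding I using G_D D_carrier by (intro A.genideal_ideal) blast
  have G_I: "?G \<subseteq> ?I" unfolding I using G_D D_carrier by (intro A.genideal_self) blast
  have "word_poly [cyc n i, cyc n (i + int n)] - 1 \<in> ?I" for i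
  proof -
    have "cancel_poly i \<in> ?I"
      using n_pos
    proof (cases rule: cyc_cases[where i = i])
      case (C j)
      then have "cancel_poly i = (D8 j :: (letter, 'k) nc_poly)"
        using poly_cong(1)[OF C(3), where 'k = 'k] cancel_poly_C[OF C(1,2), where 'k = 'k] by simp
      moreover have "(D8 j :: (letter, 'k) nc_poly) \<in> ?G" using C unfolding D8_def by auto
      ultimately show ?thesis using G_I by auto
    next
      case (Cinv j)
      then have "cancel_poly i = (D7 j :: (letter, 'k) nc_poly)"
        using poly_cong(1)[OF Cinv(3), where 'k = 'k] cancel_poly_Cinv[OF Cinv(1,2), where 'k = 'k] by simp
      moreover have "(D7 j :: (letter, 'k) nc_poly) \<in> ?G" using Cinv unfolding D7_def by auto
      ultimately show ?thesis using G_I by auto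
    qed
    then show ?thesis by (simp add: cancel_poly_def word_poly_Nil)
  qed
  moreover have "word_poly (run 1 1 n) - word_poly (run (-1) (1 + (int n - 1)) n) \<in> ?I"
    using G_I up_C[of 1 n] down_C[of 1 n] by auto
  ultimately have rules_I: "word_poly u - word_poly v \<in> ?I" if "(u, v) \<in> rules" for u v
    using rules_word_cong[of ?I 1 u v] ideal alphabet that by simp
  have "D g \<subseteq> ?I"
  proof
    fix p :: "(letter, 'k) nc_poly"
    assume "p \<in> D g"
    then obtain u v where "(u, v) \<in> rules" "p = word_poly u - word_poly v"
      using rules_D[OF g, where 'k = 'k] by blast
    then show "p \<in> ?I" using rules_I by simp
  qed
  \<comment> \<open>The generators of the presentation are themselves among the elements of
    \<open>D\<close>, and conversely all of \<open>D\<close> follows from them by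
    \<open>rules_I\<close>.\<close>
  have D_I: "genideal ?A (D g) = ?I"
  proof (rule equalityI)
    show "genideal ?A (D g) \<subseteq> ?I" by (rule A.genideal_minimal[OF ideal]) fact
    show "?I \<subseteq> genideal ?A (D g)"
      unfolding I using G_D A.genideal_self[OF D_carrier]
      by (intro A.genideal_minimal[OF A.genideal_ideal[OF D_carrier]]) (rule subset_trans)
  qed
  \<comment> \<open>The same two kinds of generators lie in the annihilator: inverse letters act as
    inverse maps, and \<open>word_act_run\<close> equates the two sides of the relator.
    \<open>rules_word_cong\<close> then carries this over to all of \<open>D\<close>.\<close>
  have cancel_J: "word_poly [cyc n i, cyc n (i + int n)] - 1 \<in> (annihilator :: (letter, 'k) nc_poly set)" for i
    using word_diff_annihilator[of "[cyc n i, cyc n (i + int n)]" "[]", where 'k = 'k]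
    by (simp add: word_poly_Nil act_inverse')
  have run_J: "word_poly (run 1 1 n) - word_poly (run (-1) (1 + (int n - 1)) n)
      \<in> (annihilator :: (letter, 'k) nc_poly set)"
    using set_run[of 1 1 n] set_run[of "-1" "1 + (int n - 1)" n] word_act_run[of 1]
    by (intro word_diff_annihilator) auto
  have "ideal (annihilator :: (letter, 'k) nc_poly set) ?A"
    using ideal_annihilator alphabet by simp
  moreover have "D g \<subseteq> (annihilator :: (letter, 'k) nc_poly set)"
  proof
    fix p :: "(letter, 'k) nc_poly"
    assume "p \<in> D g"
    then obtain u v where "(u, v) \<in> rules" "p = word_poly u - word_poly v"
      using rules_D[OF g, where 'k = 'k] by blast
    then show "p \<in> annihilator"
      using rules_word_cong[OF ideal_annihilator cancel_J run_J] by simp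
  qed
  ultimately have I_J: "?I \<subseteq> annihilator"
    using A.genideal_minimal D_I by blast
  have "groebner_shirshov_basis (alphabet g) word_order
      {word_poly u - word_poly v | u v. (u, v) \<in> rules} ?I"
  proof (rule word_order.groebner_shirshov_basis_binomials)
    show "u \<in> lists (alphabet g) \<and> v \<in> lists (alphabet g) \<and> (v, u) \<in> word_order"
      if "(u, v) \<in> rules" for u v
      using rules[OF that] by auto
    show "wf (word_order \<inter> lists (alphabet g) \<times> lists (alphabet g))" by (rule wf_word_order)
    show "genideal ?A {word_poly u - word_poly v | u v. (u, v) \<in> rules} = ?I"
      unfolding rules_D[OF g] by (rule D_I)
    show "\<exists>\<gamma> u v \<delta>. (u, v) \<in> rules \<and> leading_word word_order f = \<gamma> @ u @ \<delta>"
      if "f \<in> ?I" "f \<noteq> 0" for f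
      using leading_word_redex that I_J by blast
  qed
  then show ?thesis unfolding rules_D[OF g] .
qed

end
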